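(* Let $n\ge2$, and let $g$ be a smooth Riemannian metric on the standard affine torus $\mathbb{T}^n=\mathbb{R}^n/\mathbb{Z}^n$. For a primitive $p\in\mathbb{Z}^n$ let $\mathcal{F}_p=\{\Sigma_{p,s}\}_{s\in S^1}$, where $\Sigma_{p,s}=\{x\in\mathbb{T}^n: p\cdot x=s \pmod 1\}$. Suppose that for every primitive $p\in\mathbb{Z}^n$, every leaf of the affine foliation $\mathcal{F}_p$ is $g$-minimal. Then the coefficients of $g$ are constant in the standard affine coordinates. In particular, $g$ is flat.
   Context: $S^1=\mathbb{R}/\mathbb{Z}$. A vector $p\in\mathbb{Z}^n$ is primitive if its entries are coprime. The standard affine coordinates on $\mathbb{T}^n$ are those induced from $\mathbb{R}^n$. A hypersurface is $g$-minimal if its mean curvature with respect to $g$ vanishes identically. *)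

theory Defs
  imports "HOL-Analysis.Analysis"
begin

section \<open>The torus and the circle\<close>

definition torus_rel :: "real^('n::finite) \<Rightarrow> real^'n \<Rightarrow> bool" where
  "torus_rel x y \<longleftrightarrow> (\<forall>i. x $ i - y $ i \<in> \<int>)"

lemma equivp_torus_rel: "equivp torus_rel"
proof (rule equivpI)
  show "reflp torus_rel"
    by (simp add: reflp_def torus_rel_def)
  show "symp torus_rel"
    unfolding symp_def torus_rel_def by (metis Ints_minus minus_diff_eq)
  show "transp torus_rel"
    unfolding transp_def torus_rel_def
    by (metis (no_types, opaque_lifting) Ints_add diff_add_cancel add_diff_eq)
qed

quotient_type 'n torus = "real^('n::finite)" / torus_rel
  by (rule equivp_torus_rel)

definition circle_rel :: "real \<Rightarrow> real \<Rightarrow> bool" where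
  "circle_rel s t \<longleftrightarrow> s - t \<in> \<int>"

lemma equivp_circle_rel: "equivp circle_rel"
proof (rule equivpI)
  show "reflp circle_rel"
    by (simp add: reflp_def circle_rel_def)
  show "symp circle_rel"
    unfolding symp_def circle_rel_def by (metis Ints_minus minus_diff_eq)
  show "transp circle_rel"
    unfolding transp_def circle_rel_def
    by (metis (no_types, opaque_lifting) Ints_add diff_add_cancel add_diff_eq)
qed

quotient_type circle = real / circle_rel
  by (rule equivp_circle_rel)

text \<open>The map \<open>abs_torus\<close> is the covering projection; the torus gets the quotient topology.\<close>

instantiation torus :: (finite) topological_space
begin

definition open_torus :: "'a torus set \<Rightarrow> bool" where
  "open_torus U \<longleftrightarrow> open (abs_torus -` U)"

instance
proof
  show "open (UNIV :: 'a torus set)"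
    by (simp add: open_torus_def)
  show "open (S \<inter> T)" if "open S" "open T" for S T :: "'a torus set"
    using that by (simp add: open_torus_def open_Int)
  show "open (\<Union>K)" if "\<forall>S\<in>K. open S" for K :: "'a torus set set"
    using that by (auto simp: open_torus_def vimage_Union)
qed

end

section \<open>Smooth functions\<close>

text \<open>\<open>Ck k U f\<close> is meant for open \<open>U\<close>.\<close>

primrec Ck :: "nat \<Rightarrow> 'a::euclidean_space set \<Rightarrow> ('a \<Rightarrow> 'b::real_normed_vector) \<Rightarrow> bool" where
  "Ck 0 U f \<longleftrightarrow> continuous_on U f"
| "Ck (Suc k) U f \<longleftrightarrow>
     (\<forall>x\<in>U. f differentiable (at x)) \<and> (\<forall>v. Ck k U (\<lambda>x. frechet_derivative f (at x) v))"

definition smooth_on :: "'a::euclidean_space set \<Rightarrow> ('a \<Rightarrow> 'b::real_normed_vector) \<Rightarrow> bool" where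
  "smooth_on U f \<longleftrightarrow> (\<forall>k. Ck k U f)"

definition torus_smooth_on :: "'n::finite torus set \<Rightarrow> ('n torus \<Rightarrow> 'b::real_normed_vector) \<Rightarrow> bool" where
  "torus_smooth_on U f \<longleftrightarrow> smooth_on (abs_torus -` U) (f \<circ> abs_torus)"

text \<open>The derivative of \<open>f\<close> at \<open>x\<close> in direction \<open>v\<close>, every tangent space being identified with
  \<open>real^'n\<close> by the affine coordinates. As \<open>f \<circ> abs_torus\<close> is periodic, the choice of
  representative of \<open>x\<close> does not matter.\<close>

definition torus_deriv :: "('n::finite torus \<Rightarrow> 'b::real_normed_vector) \<Rightarrow> 'n torus \<Rightarrow> real^'n \<Rightarrow> 'b" where
  "torus_deriv f x v = frechet_derivative (f \<circ> abs_torus) (at (rep_torus x)) v"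

section \<open>Riemannian metrics\<close>

text \<open>A metric is given by its coefficient matrix in the affine coordinates.\<close>

type_synonym 'n metric = "'n torus \<Rightarrow> real^'n^'n"

definition gprod :: "'n::finite metric \<Rightarrow> 'n torus \<Rightarrow> real^'n \<Rightarrow> real^'n \<Rightarrow> real" where
  "gprod g x v w = v \<bullet> (g x *v w)"

definition riemannian_metric :: "'n::finite metric \<Rightarrow> bool" where
  "riemannian_metric g \<longleftrightarrow> torus_smooth_on UNIV g \<and>
     (\<forall>x. (\<forall>v w. gprod g x v w = gprod g x w v) \<and> (\<forall>v. v \<noteq> 0 \<longrightarrow> gprod g x v v > 0))"

definition christoffel :: "'n::finite metric \<Rightarrow> 'n \<Rightarrow> 'n \<Rightarrow> 'n \<Rightarrow> 'n torus \<Rightarrow> real" where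
  "christoffel g k i j x = (1/2) * (\<Sum>l\<in>UNIV. matrix_inv (g x) $ k $ l *
     (torus_deriv (\<lambda>y. g y $ j $ l) x (axis i 1)
    + torus_deriv (\<lambda>y. g y $ i $ l) x (axis j 1)
    - torus_deriv (\<lambda>y. g y $ i $ j) x (axis l 1)))"

text \<open>Levi-Civita covariant derivative of the vector field \<open>Y\<close> in direction \<open>v\<close> at \<open>x\<close>.\<close>

definition cov_deriv :: "'n::finite metric \<Rightarrow> ('n torus \<Rightarrow> real^'n) \<Rightarrow> 'n torus \<Rightarrow> real^'n \<Rightarrow> real^'n" where
  "cov_deriv g Y x v = torus_deriv Y x v
     + (\<chi> k. \<Sum>i\<in>UNIV. \<Sum>j\<in>UNIV. christoffel g k i j x * v $ i * Y x $ j)"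

text \<open>The component \<open>l\<close> of \<open>R(\<partial>\<^sub>i, \<partial>\<^sub>j) \<partial>\<^sub>k\<close>.\<close>

definition riemann_curvature :: "'n::finite metric \<Rightarrow> 'n \<Rightarrow> 'n \<Rightarrow> 'n \<Rightarrow> 'n \<Rightarrow> 'n torus \<Rightarrow> real" where
  "riemann_curvature g l k i j x =
     torus_deriv (christoffel g l j k) x (axis i 1)
   - torus_deriv (christoffel g l i k) x (axis j 1)
   + (\<Sum>m\<in>UNIV. christoffel g l i m x * christoffel g m j k x
               - christoffel g l j m x * christoffel g m i k x)"

definition flat :: "'n::finite metric \<Rightarrow> bool" where
  "flat g \<longleftrightarrow> (\<forall>l k i j x. riemann_curvature g l k i j x = 0)"

section \<open>Hypersurfaces and mean curvature\<close>

definition smooth_hypersurface :: "'n::finite torus set \<Rightarrow> bool" where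
  "smooth_hypersurface S \<longleftrightarrow> (\<forall>x\<in>S. \<exists>U (\<phi> :: 'n torus \<Rightarrow> real).
     open U \<and> x \<in> U \<and> torus_smooth_on U \<phi> \<and> S \<inter> U = {y\<in>U. \<phi> y = 0} \<and>
     (\<forall>y\<in>U. \<exists>v. torus_deriv \<phi> y v \<noteq> 0))"

text \<open>The velocities at \<open>x\<close> of smooth curves in \<open>S\<close>; \<open>c\<close> is a lift of such a curve to \<open>real^'n\<close>.\<close>

definition tangent_space :: "'n::finite torus set \<Rightarrow> 'n torus \<Rightarrow> (real^'n) set" where
  "tangent_space S x = {v. \<exists>(c :: real \<Rightarrow> real^'n) \<epsilon>. \<epsilon> > 0 \<and> smooth_on {-\<epsilon><..<\<epsilon>} c \<and>
     (\<forall>t\<in>{-\<epsilon><..<\<epsilon>}. abs_torus (c t) \<in> S) \<and> abs_torus (c 0) = x \<and>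
     (c has_vector_derivative v) (at 0)}"

text \<open>\<open>N\<close> is smooth on the open set \<open>U\<close> of the torus, but is required to be a unit normal only along
  \<open>S \<inter> U\<close>; what follows uses its derivatives in directions tangent to \<open>S\<close> only.\<close>

definition unit_normal_field ::
    "'n::finite metric \<Rightarrow> 'n torus set \<Rightarrow> 'n torus set \<Rightarrow> ('n torus \<Rightarrow> real^'n) \<Rightarrow> bool" where
  "unit_normal_field g S U N \<longleftrightarrow> open U \<and> torus_smooth_on U N \<and>
     (\<forall>x \<in> S \<inter> U. gprod g x (N x) (N x) = 1 \<and> (\<forall>v\<in>tangent_space S x. gprod g x (N x) v = 0))"

definition second_fundamental_form ::
    "'n::finite metric \<Rightarrow> ('n torus \<Rightarrow> real^'n) \<Rightarrow> 'n torus \<Rightarrow> real^'n \<Rightarrow> real^'n \<Rightarrow> real" where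
  "second_fundamental_form g N x v w = - gprod g x (cov_deriv g N x v) w"

definition orthonormal_basis ::
    "'n::finite metric \<Rightarrow> 'n torus \<Rightarrow> (real^'n) set \<Rightarrow> (real^'n) set \<Rightarrow> bool" where
  "orthonormal_basis g x V B \<longleftrightarrow> span B = V \<and>
     (\<forall>e\<in>B. \<forall>f\<in>B. gprod g x e f = (if e = f then 1 else 0))"

text \<open>The unnormalised trace of the second fundamental form, which does not depend on the choice
  of orthonormal basis.\<close>

definition mean_curvature ::
    "'n::finite metric \<Rightarrow> 'n torus set \<Rightarrow> ('n torus \<Rightarrow> real^'n) \<Rightarrow> 'n torus \<Rightarrow> real" where
  "mean_curvature g S N x =
     (\<Sum>e \<in> (SOME B. orthonormal_basis g x (tangent_space S x) B). second_fundamental_form g N x e e)"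

definition minimal_hypersurface :: "'n::finite metric \<Rightarrow> 'n torus set \<Rightarrow> bool" where
  "minimal_hypersurface g S \<longleftrightarrow> smooth_hypersurface S \<and>
     (\<forall>U N. unit_normal_field g S U N \<longrightarrow> (\<forall>x \<in> S \<inter> U. mean_curvature g S N x = 0))"

section \<open>The affine foliations\<close>

definition primitive :: "int^'n \<Rightarrow> bool" where
  "primitive p \<longleftrightarrow> Gcd (range (($) p)) = 1"

lift_definition torus_pairing :: "int^'n \<Rightarrow> 'n::finite torus \<Rightarrow> circle" is
  "\<lambda>p x. \<Sum>i\<in>UNIV. real_of_int (p $ i) * x $ i"
proof -
  fix p :: "int^'n" and x y :: "real^'n"
  assume "torus_rel x y"
  then have "(\<Sum>i\<in>UNIV. real_of_int (p $ i) * (x $ i - y $ i)) \<in> \<int>"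
    unfolding torus_rel_def by (intro Ints_sum Ints_mult) auto
  then show "circle_rel (\<Sum>i\<in>UNIV. real_of_int (p $ i) * x $ i) (\<Sum>i\<in>UNIV. real_of_int (p $ i) * y $ i)"
    unfolding circle_rel_def by (simp add: right_diff_distrib sum_subtractf)
qed

definition leaf :: "int^'n \<Rightarrow> circle \<Rightarrow> 'n::finite torus set" where
  "leaf p s = {x. torus_pairing p x = s}"

text \<open>The leaves are smooth hypersurfaces, so that \<open>minimal_hypersurface g (leaf p s)\<close> says exactly that
  the mean curvature of the leaf vanishes; their tangent spaces are the expected hyperplanes.\<close>

lemma sin_has_derivative:
  fixes b :: "'a::euclidean_space"
  shows "((\<lambda>x. a * sin (b \<bullet> x + c)) has_derivative (\<lambda>v. a * (b \<bullet> v) * sin (b \<bullet> x + (c + pi/2)))) (at x)"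
proof -
  have "sin (b \<bullet> x + (c + pi/2)) = cos (b \<bullet> x + c)"
    by (simp add: sin_add cos_add)
  then show ?thesis
    by (auto intro!: derivative_eq_intros)
qed

lemma Ck_sin:
  fixes b :: "'a::euclidean_space"
  shows "Ck k U (\<lambda>x. a * sin (b \<bullet> x + c))"
proof (induction k arbitrary: a c)
  case 0
  then show ?case by (simp, intro continuous_intros)
next
  case (Suc k)
  have "frechet_derivative (\<lambda>x. a * sin (b \<bullet> x + c)) (at x) = (\<lambda>v. a * (b \<bullet> v) * sin (b \<bullet> x + (c + pi/2)))" for x
    using sin_has_derivative frechet_derivative_at by metis
  moreover have "(\<lambda>x. a * sin (b \<bullet> x + c)) differentiable (at x)" for x
    using sin_has_derivative differentiableI by metis
  ultimately show ?case
    using Suc by simp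
qed

lemma leaf_smooth_hypersurface:
  fixes p :: "int^'n::finite"
  assumes "primitive p"
  shows "smooth_hypersurface (leaf p s)"
proof -
  define q :: "real^'n" where "q = (\<chi> i. real_of_int (p $ i))"
  define s0 where "s0 = rep_circle s"
  have q0: "q \<noteq> 0"
  proof
    assume "q = 0"
    then have "p $ i = 0" for i by (simp add: q_def vec_eq_iff)
    then have "range (($) p) = {0}" by auto
    then show False using assms by (simp add: primitive_def)
  qed
  have pair: "torus_pairing p (abs_torus x) = abs_circle (q \<bullet> x)" for x
    by (simp add: torus_pairing.abs_eq q_def inner_vec_def)
  have s: "s = abs_circle s0"
    using Quotient_circle unfolding s0_def by (simp add: Quotient_abs_rep)
  have inleaf: "abs_torus x \<in> leaf p s \<longleftrightarrow> q \<bullet> x - s0 \<in> \<int>" for x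
    by (simp add: leaf_def pair s circle.abs_eq_iff circle_rel_def)
  have repabs: "q \<bullet> rep_torus (abs_torus x) - q \<bullet> x \<in> \<int>" for x
  proof -
    have "abs_torus (rep_torus (abs_torus x)) = abs_torus x"
      by (rule Quotient_abs_rep[OF Quotient_torus])
    then show ?thesis by (metis pair circle.abs_eq_iff circle_rel_def)
  qed
  define \<phi> :: "'n torus \<Rightarrow> real" where "\<phi> y = sin (2 * pi * (q \<bullet> rep_torus y - s0))" for y
  define \<psi> :: "'n torus \<Rightarrow> real" where "\<psi> y = cos (2 * pi * (q \<bullet> rep_torus y - s0))" for y
  define U where "U = {y. \<psi> y > 0}"
  have per: "sin (2 * pi * (q \<bullet> rep_torus (abs_torus x) - s0)) = sin (2 * pi * (q \<bullet> x - s0))"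
     "cos (2 * pi * (q \<bullet> rep_torus (abs_torus x) - s0)) = cos (2 * pi * (q \<bullet> x - s0))" for x
  proof -
    obtain m :: int where "q \<bullet> rep_torus (abs_torus x) - q \<bullet> x = m"
      using repabs[of x] by (auto elim: Ints_cases)
    then have "2 * pi * (q \<bullet> rep_torus (abs_torus x) - s0) = 2 * pi * (q \<bullet> x - s0) + 2 * pi * m"
      by (simp add: algebra_simps)
    moreover have "sin (2 * pi * real_of_int m) = 0" "cos (2 * pi * real_of_int m) = 1" 
      using sin_int_2pin cos_int_2pin by (auto simp: mult.commute)
    ultimately show "sin (2 * pi * (q \<bullet> rep_torus (abs_torus x) - s0)) = sin (2 * pi * (q \<bullet> x - s0))"
     "cos (2 * pi * (q \<bullet> rep_torus (abs_torus x) - s0)) = cos (2 * pi * (q \<bullet> x - s0))"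
      by (simp_all add: sin_add cos_add)
  qed
  define b where "b = (2 * pi) *\<^sub>R q"
  define c where "c = - (2 * pi * s0)"
  have arg: "b \<bullet> x + c = 2 * pi * (q \<bullet> x - s0)" for x
    by (simp add: b_def c_def algebra_simps)
  have ps: "\<phi> \<circ> abs_torus = (\<lambda>x. 1 * sin (b \<bullet> x + c))" 
     "\<psi> \<circ> abs_torus = (\<lambda>x. cos (b \<bullet> x + c))"
    by (simp_all only: \<phi>_def \<psi>_def per arg o_def mult_1)
  have "open U"
  proof -
    have "abs_torus -` U = {x. cos (b \<bullet> x + c) > 0}"
      using ps(2) by (auto simp: U_def fun_eq_iff)
    moreover have "open {x. cos (b \<bullet> x + c) > 0}"
      by (intro open_Collect_less continuous_intros)
    ultimately show ?thesis by (simp add: open_torus_def)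
  qed
  moreover have "torus_smooth_on U \<phi>"
    unfolding torus_smooth_on_def smooth_on_def ps using Ck_sin by blast
  moreover have "\<exists>v. torus_deriv \<phi> y v \<noteq> 0" if "y \<in> U" for y
  proof -
    have "frechet_derivative (\<phi> \<circ> abs_torus) (at (rep_torus y)) = (\<lambda>v. 1 * (b \<bullet> v) * sin (b \<bullet> rep_torus y + (c + pi/2)))"
      unfolding ps using sin_has_derivative frechet_derivative_at by metis
    then have "torus_deriv \<phi> y b = (b \<bullet> b) * cos (b \<bullet> rep_torus y + c)"
      by (simp add: torus_deriv_def sin_add cos_add)
    moreover have "cos (b \<bullet> rep_torus y + c) > 0"
      using that by (simp only: U_def \<psi>_def arg mem_Collect_eq)
    moreover have "b \<bullet> b \<noteq> 0" using q0 by (simp add: b_def)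
    ultimately show ?thesis by (metis less_irrefl mult_eq_0_iff)
  qed
  moreover have "leaf p s \<subseteq> U" "leaf p s \<inter> U = {y\<in>U. \<phi> y = 0}"
  proof -
    have *: "y \<in> leaf p s \<longleftrightarrow> y \<in> U \<and> \<phi> y = 0" for y
    proof -
      have "y = abs_torus (rep_torus y)" by (simp add: Quotient_abs_rep[OF Quotient_torus])
      then have "y \<in> leaf p s \<longleftrightarrow> q \<bullet> rep_torus y - s0 \<in> \<int>" using inleaf by metis
      also have "\<dots> \<longleftrightarrow> cos (2 * pi * (q \<bullet> rep_torus y - s0)) = 1"
      proof -
        have "2 * pi * r = of_int m * 2 * pi \<longleftrightarrow> r = of_int m" for r :: real and m :: int
          by (auto simp: mult.commute)
        then show ?thesis
          unfolding cos_one_2pi_int by (auto elim: Ints_cases)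
      qed
      also have "\<dots> \<longleftrightarrow> y \<in> U \<and> \<phi> y = 0"
        unfolding U_def \<phi>_def \<psi>_def 
        by (auto simp: cos_one_sin_zero) (metis cos_one_sin_zero sin_zero_abs_cos_one abs_of_pos)
      finally show ?thesis .
    qed
    show "leaf p s \<subseteq> U" "leaf p s \<inter> U = {y\<in>U. \<phi> y = 0}" using * by auto
  qed
  ultimately show ?thesis
    unfolding smooth_hypersurface_def by blast
qed


lemma Ck_const: "Ck k U (\<lambda>x::'a::euclidean_space. c :: 'b::real_normed_vector)"
  by (induction k arbitrary: c) (auto)

lemma Ck_affine: "Ck k U (\<lambda>t::real. a + t *\<^sub>R v)"
proof (cases k)
  case 0
  then show ?thesis by (simp, intro continuous_intros)
next
  case (Suc m)
  have d: "((\<lambda>t::real. a + t *\<^sub>R v) has_derivative (\<lambda>h. h *\<^sub>R v)) (at t)" for t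
    by (auto intro!: derivative_eq_intros)
  then have "frechet_derivative (\<lambda>t::real. a + t *\<^sub>R v) (at t) = (\<lambda>h. h *\<^sub>R v)" for t
    using frechet_derivative_at by metis
  then show ?thesis using Suc d Ck_const by (auto simp: differentiable_def)
qed

lemma tangent_space_leaf:
  fixes p :: "int^'n::finite"
  assumes "x \<in> leaf p s"
  shows "tangent_space (leaf p s) x = {v. (\<chi> i. real_of_int (p $ i)) \<bullet> v = 0}"
proof -
  define q :: "real^'n" where "q = (\<chi> i. real_of_int (p $ i))"
  define s0 where "s0 = rep_circle s"
  have pair: "torus_pairing p (abs_torus x) = abs_circle (q \<bullet> x)" for x
    by (simp add: torus_pairing.abs_eq q_def inner_vec_def)
  have s: "s = abs_circle s0"
    using Quotient_circle unfolding s0_def by (simp add: Quotient_abs_rep)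
  have inleaf: "abs_torus x \<in> leaf p s \<longleftrightarrow> q \<bullet> x - s0 \<in> \<int>" for x
    by (simp add: leaf_def pair s circle.abs_eq_iff circle_rel_def)
  have xx: "x = abs_torus (rep_torus x)" by (simp add: Quotient_abs_rep[OF Quotient_torus])
  have 1: "v \<in> tangent_space (leaf p s) x" if "q \<bullet> v = 0" for v
  proof -
    have "((\<lambda>t. rep_torus x + t *\<^sub>R v) has_vector_derivative v) (at 0)"
      by (auto intro!: derivative_eq_intros)
    moreover have "abs_torus (rep_torus x + t *\<^sub>R v) \<in> leaf p s" for t
    proof -
      have "q \<bullet> rep_torus x - s0 \<in> \<int>"
        using assms inleaf[of "rep_torus x"] xx[symmetric] by simp
      then show ?thesis
        by (simp add: inleaf inner_add_right that)
    qed
    ultimately show ?thesis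
      unfolding tangent_space_def smooth_on_def using Ck_affine xx[symmetric]
      by (auto intro!: exI[of _ "\<lambda>t. rep_torus x + t *\<^sub>R v"] exI[of _ 1])
  qed
  have 2: "q \<bullet> v = 0" if v: "v \<in> tangent_space (leaf p s) x" for v
  proof -
    obtain c and e :: real where e: "e > 0" and c: "\<And>t. t \<in> {-e<..<e} \<Longrightarrow> abs_torus (c t) \<in> leaf p s"
      "(c has_vector_derivative v) (at 0)"
      using v unfolding tangent_space_def by blast
    have i: "q \<bullet> c t - s0 \<in> \<int>" if "t \<in> {-e<..<e}" for t using c(1) that inleaf by blast
    have z: "sin (2 * pi * (q \<bullet> c t - s0)) = 0" "cos (2 * pi * (q \<bullet> c t - s0)) = 1" if "t \<in> {-e<..<e}" for t
      using i[OF that] sin_int_2pin cos_int_2pin by (auto elim!: Ints_cases simp: mult.commute)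
    have "((\<lambda>t. q \<bullet> c t) has_real_derivative (q \<bullet> v)) (at 0)"
      using c(2) unfolding has_real_derivative_iff_has_vector_derivative
      by (rule bounded_linear.has_vector_derivative[OF bounded_linear_inner_right])
    then have "((\<lambda>t. sin (2 * pi * (q \<bullet> c t - s0))) has_real_derivative
       2 * pi * (q \<bullet> v) * cos (2 * pi * (q \<bullet> c 0 - s0))) (at 0)"
      by (auto intro!: derivative_eq_intros)
    then have "((\<lambda>t. 0) has_real_derivative 2 * pi * (q \<bullet> v) * cos (2 * pi * (q \<bullet> c 0 - s0))) (at 0)"
      by (rule has_field_derivative_transform_within_open[of _ _ _ "{-e<..<e}"]) (use e z in auto)
    then have "2 * pi * (q \<bullet> v) * cos (2 * pi * (q \<bullet> c 0 - s0)) = 0"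
      using DERIV_const DERIV_unique by metis
    then show ?thesis using z(2)[of 0] e by simp
  qed
  show ?thesis using 1 2 unfolding q_def by blast
qed

end

theory Submission
  imports Defs
begin

text \<open>Write \<open>dg\<^sub>u\<close> for the derivative of the coefficient matrix of the metric in direction \<open>u\<close>, and put
\<open>\<lambda>(v) = \<Sum>\<^sub>e (dg\<^sub>e(v, e) - dg\<^sub>v(e, e) / 2)\<close> at each point, summed over any orthonormal basis. In affine
coordinates, \<open>leaf p s\<close> is locally a level set of a linear function, so its second fundamental form involves
only \<open>dg\<close> and the unit normal \<open>N\<close>, the normalised dual vector of \<open>p\<close>. Minimality of the leaf through a point becomes
\<open>dg\<^sub>N(N, N) = 2 \<lambda>(N)\<close> there (\<open>minimal_leaf_normal\<close>). Rational directions are dense and all terms are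
homogeneous in \<open>N\<close>, so
\<open>dg\<^sub>v(v, v) = 2 \<lambda>(v) g(v, v)\<close> for all vectors \<open>v\<close> at all points (\<open>minimal_leaves_cubic_identity\<close>).

Polarising this identity and taking a trace expresses the trace of \<open>dg\<^sub>v\<close> as \<open>(n + 1) \<lambda>(v)\<close>
(\<open>cubic_identity_trace\<close>). By Jacobi's formula that trace is the derivative of \<open>ln (det g)\<close>, so \<open>\<lambda>\<close> is
exact, and the cubic identity says that the rescaled tensor \<open>h = (det g) powr (- 2 / (n + 1)) g\<close> satisfies
\<open>dh\<^sub>v(v, v) = 0\<close>: it is a Killing tensor of the flat torus, that is, \<open>h(v, v)\<close> is constant along every line
of direction \<open>v\<close> (\<open>rescaled_constant_along_lines\<close>).

Joining two points of the universal cover by a line, and then replacing one of them by its lattice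
translates, shows that the values of \<open>h\<close> at the two points agree on a coset of the lattice. Two quadratic
forms that agree there are equal, so \<open>h\<close> is constant (\<open>constant_along_lines_periodic\<close>). Comparing
determinants, the conformal factor is constant because \<open>n \<noteq> 1\<close>, hence so is \<open>g\<close> (\<open>metric_constant\<close>), and
then all Christoffel symbols vanish.\<close>

section \<open>Positive definite bilinear forms and orthonormal bases\<close>

definition bform :: "real^'n::finite^'n \<Rightarrow> real^'n \<Rightarrow> real^'n \<Rightarrow> real" where
  "bform A v w = v \<bullet> (A *v w)"

definition spd :: "real^'n::finite^'n \<Rightarrow> bool" where
  "spd A \<longleftrightarrow> (\<forall>v w. bform A v w = bform A w v) \<and> (\<forall>v. v \<noteq> 0 \<longrightarrow> bform A v v > 0)"

definition orthonormal_wrt :: "real^'n::finite^'n \<Rightarrow> (real^'n) set \<Rightarrow> bool" where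
  "orthonormal_wrt A B \<longleftrightarrow> (\<forall>e\<in>B. \<forall>f\<in>B. bform A e f = (if e = f then 1 else 0))"

lemma bform_simps [simp]:
  "bform A (v + w) u = bform A v u + bform A w u"
  "bform A v (w + u) = bform A v w + bform A v u"
  "bform A (v - w) u = bform A v u - bform A w u"
  "bform A v (w - u) = bform A v w - bform A v u"
  "bform A (r *\<^sub>R v) u = r * bform A v u"
  "bform A v (r *\<^sub>R u) = r * bform A v u"
  "bform A 0 v = 0" "bform A v 0 = 0"
  "bform (A + C) v u = bform A v u + bform C v u"
  "bform (A - C) v u = bform A v u - bform C v u"
  "bform (r *\<^sub>R A) v u = r * bform A v u"
  "bform 0 v u = 0"
  by (simp_all add: bform_def inner_add_left inner_add_right inner_diff_left inner_diff_right
      matrix_vector_right_distrib matrix_vector_mult_diff_distrib matrix_vector_mult_add_rdistrib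
      matrix_vector_mult_diff_rdistrib matrix_vector_mult_scaleR scaleR_matrix_vector_assoc[symmetric])

lemma bform_sum_left: "bform A (sum f S) v = (\<Sum>i\<in>S. bform A (f i) v)"
  by (simp add: bform_def inner_sum_left)

lemma bform_eq_sum: "bform A v w = (\<Sum>i\<in>UNIV. \<Sum>j\<in>UNIV. A $ i $ j * v $ i * w $ j)"
  by (simp add: bform_def inner_vec_def matrix_vector_mult_def sum_distrib_left mult_ac)

lemma bform_axis: "bform A (axis i 1) (axis j 1) = A $ i $ j"
  by (simp add: bform_def inner_axis' matrix_vector_mul_component inner_axis)

lemma spd_sym: "spd A \<Longrightarrow> bform A v w = bform A w v"
  by (simp add: spd_def)

lemma spd_pos: "spd A \<Longrightarrow> v \<noteq> 0 \<Longrightarrow> bform A v v > 0"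
  by (simp add: spd_def)

lemma spd_zero: "spd A \<Longrightarrow> bform A v v = 0 \<Longrightarrow> v = 0"
  by (metis less_irrefl spd_pos)

lemma spd_invertible:
  assumes "spd A"
  shows "invertible A"
proof -
  have "A *v v = 0 \<Longrightarrow> v = 0" for v
    using spd_zero[OF assms, of v] by (simp add: bform_def)
  then show ?thesis
    by (metis matrix_left_invertible_ker invertible_left_inverse)
qed

lemma spd_det_nz: "spd A \<Longrightarrow> det A \<noteq> 0"
  using spd_invertible invertible_det_nz by blast

lemma bform_zero_on_span:
  fixes A :: "real^'n::finite^'n"
  assumes "\<And>f. f \<in> B \<Longrightarrow> bform A d f = 0" "y \<in> span B"
  shows "bform A d y = 0"
proof -
  have "span B \<subseteq> {y. bform A d y = 0}"
    using assms(1) by (intro span_minimal) (auto simp: subspace_def)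
  then show ?thesis using assms(2) by blast
qed

lemma orthonormal_wrt_independent:
  fixes A :: "real^'n::finite^'n"
  assumes "orthonormal_wrt A B"
  shows "independent B"
proof -
  have "e \<notin> span (B - {e})" if "e \<in> B" for e
  proof
    assume "e \<in> span (B - {e})"
    then have "bform A e e = 0"
      by (rule bform_zero_on_span[rotated]) (use assms that in \<open>auto simp: orthonormal_wrt_def\<close>)
    then show False using assms that by (auto simp: orthonormal_wrt_def)
  qed
  then show ?thesis by (auto simp: dependent_def)
qed

lemma orthonormal_wrt_finite: "orthonormal_wrt A B \<Longrightarrow> finite B"
  by (rule independent_imp_finite[OF orthonormal_wrt_independent])

lemma orthonormal_wrt_card:
  fixes A :: "real^'n::finite^'n"
  assumes "orthonormal_wrt A B" "span B = UNIV"
  shows "card B = CARD('n)"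
  using dim_eq_card[of B UNIV] orthonormal_wrt_independent[OF assms(1)] assms(2) by simp

lemma residual_orthogonal:
  fixes A :: "real^'n::finite^'n"
  assumes B: "orthonormal_wrt A B" and f: "f \<in> B"
  shows "bform A (v - (\<Sum>e\<in>B. bform A v e *\<^sub>R e)) f = 0"
proof -
  have "bform A (\<Sum>e\<in>B. bform A v e *\<^sub>R e) f = (\<Sum>e\<in>B. if e = f then bform A v e else 0)"
    unfolding bform_sum_left using B f by (auto simp: orthonormal_wrt_def intro!: sum.cong)
  also have "\<dots> = bform A v f" using orthonormal_wrt_finite[OF B] f by simp
  finally show ?thesis by simp
qed

lemma orthonormal_expansion:
  fixes A :: "real^'n::finite^'n"
  assumes A: "spd A" and B: "orthonormal_wrt A B" and v: "v \<in> span B"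
  shows "v = (\<Sum>e\<in>B. bform A v e *\<^sub>R e)"
proof -
  define d where "d = v - (\<Sum>e\<in>B. bform A v e *\<^sub>R e)"
  have orth: "bform A d f = 0" if "f \<in> B" for f
    unfolding d_def by (rule residual_orthogonal[OF B that])
  have "d \<in> span B"
    unfolding d_def by (intro span_diff v span_sum span_scale span_base)
  with orth have "bform A d d = 0" by (rule bform_zero_on_span)
  then have "d = 0" by (rule spd_zero[OF A])
  then show ?thesis by (simp add: d_def)
qed

lemma orthonormal_basis_exists:
  fixes A :: "real^'n::finite^'n"
  assumes A: "spd A"
  shows "\<exists>B. orthonormal_wrt A B \<and> span B = span S"
proof -
  have "\<exists>B. orthonormal_wrt A B \<and> span B = span S" if "finite S" for S :: "(real^'n) set"
    using that
  proof (induction S)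
    case empty
    then show ?case by (auto simp: orthonormal_wrt_def intro!: exI[of _ "{}"])
  next
    case (insert s S)
    then obtain B where B: "orthonormal_wrt A B" "span B = span S" by blast
    define d where "d = s - (\<Sum>e\<in>B. bform A s e *\<^sub>R e)"
    have orth: "bform A d f = 0" if "f \<in> B" for f
      unfolding d_def by (rule residual_orthogonal[OF B(1) that])
    have dS: "s - d \<in> span B"
      unfolding d_def by (simp, intro span_sum span_scale span_base)
    show ?case
    proof (cases "d = 0")
      case True
      then have "s \<in> span S" using dS B(2) by simp
      then show ?thesis using B by (metis span_redundant)
    next
      case False
      define r where "r = sqrt (bform A d d)"
      have r: "r > 0" "r * r = bform A d d"
        using spd_pos[OF A False] by (simp_all add: r_def)
      define e where "e = (1/r) *\<^sub>R d"
      have "bform A e e = 1" using r by (simp add: e_def r(2)[symmetric])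
      moreover have "bform A e f = 0" "bform A f e = 0" if "f \<in> B" for f
        using orth[OF that] spd_sym[OF A] by (auto simp: e_def)
      ultimately have "orthonormal_wrt A (insert e B)"
        using B(1) by (auto simp: orthonormal_wrt_def)
      moreover have "span (insert e B) = span (insert s S)"
      proof
        have sub: "span B \<subseteq> span (insert s S)" "span S \<subseteq> span (insert e B)"
          using B(2) span_mono[of S "insert s S"] span_mono[of B "insert e B"] by auto
        have "d \<in> span (insert s S)"
          using dS sub(1) span_diff[of s "insert s S" "s - d"] by (auto simp: span_base)
        then have "e \<in> span (insert s S)" by (simp add: e_def span_scale)
        then show "span (insert e B) \<subseteq> span (insert s S)"
          using sub(1) span_superset[of B] by (intro span_minimal) auto
        have "d = r *\<^sub>R e" using r by (simp add: e_def)
        then have "d \<in> span (insert e B)" by (simp add: span_base span_scale)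
        then have "(s - d) + d \<in> span (insert e B)"
          using dS sub(2) B(2) by (intro span_add) auto
        then show "span (insert s S) \<subseteq> span (insert e B)"
          using sub(2) span_superset[of S] by (intro span_minimal) auto
      qed
      ultimately show ?thesis by blast
    qed
  qed
  moreover obtain F where "finite F" "span F = span S"
    by (metis basis_exists[of "span S"] independent_imp_finite subspace_span span_minimal
        subset_antisym)
  ultimately show ?thesis by metis
qed

text \<open>Mean curvature is a trace over an orthonormal basis that depends on the leaf. Comparing different leaves
  through the same point needs traces that do not.\<close>

lemma trace_basis_independent:
  fixes A :: "real^'n::finite^'n"
  assumes A: "spd A" and B: "orthonormal_wrt A B" "span B = UNIV"
    and C: "orthonormal_wrt A C" "span C = UNIV"
    and \<beta>: "bilinear \<beta>"
  shows "(\<Sum>e\<in>B. \<beta> e e) = (\<Sum>f\<in>C. \<beta> f f :: real)"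
proof -
  have lin: "linear (\<beta> e)" "linear (\<lambda>e. \<beta> e f)" for e f using \<beta> by (auto simp: bilinear_def)
  have "(\<Sum>e\<in>B. \<beta> e e) = (\<Sum>e\<in>B. \<beta> e (\<Sum>f\<in>C. bform A e f *\<^sub>R f))"
    using orthonormal_expansion[OF A C(1)] C(2) by simp
  also have "\<dots> = (\<Sum>e\<in>B. \<Sum>f\<in>C. bform A e f * \<beta> e f)"
    by (simp add: linear_sum[OF lin(1)] linear_cmul[OF lin(1)])
  also have "\<dots> = (\<Sum>f\<in>C. \<Sum>e\<in>B. bform A f e * \<beta> e f)"
    by (subst sum.swap) (simp add: spd_sym[OF A])
  also have "\<dots> = (\<Sum>f\<in>C. \<beta> (\<Sum>e\<in>B. bform A f e *\<^sub>R e) f)"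
    by (simp add: linear_sum[OF lin(2)] linear_cmul[OF lin(2)])
  also have "\<dots> = (\<Sum>f\<in>C. \<beta> f f)"
    using orthonormal_expansion[OF A B(1)] B(2) by simp
  finally show ?thesis .
qed

text \<open>The expansion of a vector in an orthonormal basis, read as a matrix identity.\<close>

lemma orthonormal_inverse:
  fixes A :: "real^'n::finite^'n"
  assumes A: "spd A" and B: "orthonormal_wrt A B" "span B = UNIV"
  shows "(\<chi> i j. \<Sum>e\<in>B. e $ i * e $ j) ** A = mat 1"
proof -
  have "((\<chi> i j. \<Sum>e\<in>B. e $ i * e $ j) ** A) *v v = mat 1 *v v" for v
  proof -
    have "(\<chi> i j. \<Sum>e\<in>B. e $ i * e $ j) *v w = (\<Sum>e\<in>B. (e \<bullet> w) *\<^sub>R e)" for w :: "real^'n"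
      by (subst vec_eq_iff, simp add: matrix_vector_mult_def inner_vec_def sum_distrib_left sum_distrib_right)
        (subst sum.swap, simp add: mult_ac)
    then show ?thesis
      using orthonormal_expansion[OF A B(1), of v] B(2) spd_sym[OF A]
      by (simp add: matrix_vector_mul_assoc[symmetric] bform_def)
  qed
  then show ?thesis by (simp add: matrix_eq)
qed

lemma det_has_derivative:
  fixes G :: "'a::real_normed_vector \<Rightarrow> real^'n::finite^'n"
  assumes "(G has_derivative G') (at x)"
  shows "((\<lambda>x. det (G x)) has_derivative
      (\<lambda>h. \<Sum>k\<in>UNIV. det (\<chi> i. if i = k then row k (G' h) else row i (G x)))) (at x)"
proof -
  have ent: "((\<lambda>x. G x $ i $ j) has_derivative (\<lambda>h. G' h $ i $ j)) (at x)" for i j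
    by (intro bounded_linear.has_derivative[OF bounded_linear_vec_nth] assms)
  have "((\<lambda>x. det (G x)) has_derivative (\<lambda>h. \<Sum>p | p permutes UNIV. of_int (sign p) *
      (\<Sum>k\<in>UNIV. G' h $ k $ p k * (\<Prod>i\<in>UNIV - {k}. G x $ i $ p i)))) (at x)"
    unfolding det_def
    by (intro has_derivative_sum has_derivative_mult_right has_derivative_prod ent)
  moreover have "(\<Sum>p | p permutes UNIV. of_int (sign p) *
      (\<Sum>k\<in>UNIV. G' h $ k $ p k * (\<Prod>i\<in>UNIV - {k}. G x $ i $ p i)))
     = (\<Sum>k\<in>UNIV. det (\<chi> i. if i = k then row k (G' h) else row i (G x)))" for h
  proof -
    have "(\<Prod>i\<in>UNIV. (if i = k then row k (G' h) else row i (G x)) $ p i)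
        = G' h $ k $ p k * (\<Prod>i\<in>UNIV - {k}. G x $ i $ p i)" for k and p :: "'n \<Rightarrow> 'n"
      by (subst prod.remove[of _ k]) (auto simp: row_def intro!: prod.cong)
    then show ?thesis
      by (simp add: det_def sum_distrib_left) (subst sum.swap, simp add: mult_ac)
  qed
  ultimately show ?thesis by simp
qed

text \<open>Jacobi's formula, with the trace of \<open>matrix_inv (G x) ** G' h\<close> written in an orthonormal basis. Writing
  \<open>G' h = K (G x)\<close>, row \<open>k\<close> of \<open>G' h\<close> is a combination of the rows of \<open>G x\<close> in which row \<open>k\<close> has the
  coefficient \<open>K\<^sub>k\<^sub>k\<close>, so the \<open>k\<close>-th summand of the derivative of the determinant is \<open>K\<^sub>k\<^sub>k\<close> times
  \<open>det (G x)\<close>.\<close>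

lemma det_has_derivative_trace:
  fixes G :: "'a::real_normed_vector \<Rightarrow> real^'n::finite^'n"
  assumes G: "(G has_derivative G') (at x)"
    and A: "spd (G x)" and B: "orthonormal_wrt (G x) B" "span B = UNIV"
  shows "((\<lambda>x. det (G x)) has_derivative (\<lambda>h. det (G x) * (\<Sum>e\<in>B. bform (G' h) e e))) (at x)"
proof -
  define M :: "real^'n^'n" where "M = (\<chi> i j. \<Sum>e\<in>B. e $ i * e $ j)"
  have MG: "M ** G x = mat 1" unfolding M_def by (rule orthonormal_inverse[OF A B])
  have "det (\<chi> i. if i = k then row k H else row i (G x)) = (H ** M) $ k $ k * det (G x)" for k H
  proof -
    have "H = (H ** M) ** G x" by (simp add: matrix_mul_assoc[symmetric] MG)
    then have "row k H = (\<Sum>i\<in>UNIV. (row k (H ** M)) $ i *s row i (G x))"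
      by (subst (asm) vec_eq_iff) (simp add: vec_eq_iff row_def matrix_matrix_mult_def[of _ "G x"])
    then show ?thesis
      using cramer_lemma_transpose[of k "row k (H ** M)" "G x"]
      by (simp only:) (simp add: row_def)
  qed
  moreover have "(\<Sum>k\<in>UNIV. (H ** M) $ k $ k) = (\<Sum>e\<in>B. bform H e e)" for H
  proof -
    have "(\<Sum>k\<in>UNIV. (H ** M) $ k $ k) = (\<Sum>k\<in>UNIV. \<Sum>j\<in>UNIV. \<Sum>e\<in>B. H $ k $ j * e $ k * e $ j)"
      by (simp add: matrix_matrix_mult_def M_def sum_distrib_left mult_ac)
    also have "\<dots> = (\<Sum>k\<in>UNIV. \<Sum>e\<in>B. \<Sum>j\<in>UNIV. H $ k $ j * e $ k * e $ j)"
      by (intro sum.cong refl sum.swap)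
    also have "\<dots> = (\<Sum>e\<in>B. bform H e e)"
      by (subst sum.swap) (simp add: bform_eq_sum)
    finally show ?thesis .
  qed
  ultimately show ?thesis
    using det_has_derivative[OF G] by (simp add: sum_distrib_left[symmetric] mult.commute)
qed

section \<open>Smooth functions on Euclidean space\<close>

lemma Ck_differentiable: "Ck (Suc k) UNIV f \<Longrightarrow> f differentiable (at x)"
  by simp

lemma Ck_deriv: "Ck (Suc k) UNIV f \<Longrightarrow> Ck k UNIV (\<lambda>x. frechet_derivative f (at x) v)"
  by simp

lemma Ck_SucI:
  assumes "\<And>x. (f has_derivative f' x) (at x)" "\<And>v. Ck k UNIV (\<lambda>x. f' x v)"
  shows "Ck (Suc k) UNIV f"
proof -
  have "frechet_derivative f (at x) = f' x" for x
    using assms(1) frechet_derivative_at by metis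
  then show ?thesis using assms by (auto simp: differentiable_def)
qed

lemma Ck_has_derivative:
  "Ck (Suc k) UNIV f \<Longrightarrow> (f has_derivative frechet_derivative f (at x)) (at x)"
  using Ck_differentiable frechet_derivative_works by blast

lemma Ck_SucD: "Ck (Suc k) UNIV f \<Longrightarrow> Ck k UNIV f"
proof (induction k arbitrary: f)
  case 0
  then show ?case
    by (auto simp: continuous_on_eq_continuous_at intro: differentiable_imp_continuous_within)
next
  case (Suc k)
  show ?case
    by (rule Ck_SucI[OF Ck_has_derivative[OF Suc.prems] Suc.IH[OF Ck_deriv[OF Suc.prems]]])
qed

lemma Ck_add: "Ck k UNIV f \<Longrightarrow> Ck k UNIV g \<Longrightarrow> Ck k UNIV (\<lambda>x. f x + g x)"
proof (induction k arbitrary: f g)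
  case 0
  then show ?case by (auto intro: continuous_on_add)
next
  case (Suc k)
  show ?case
    by (rule Ck_SucI, rule has_derivative_add[OF Suc.prems[THEN Ck_has_derivative]])
      (intro Suc.IH Suc.prems[THEN Ck_deriv])
qed

lemma Ck_sum: "(\<And>i. i \<in> S \<Longrightarrow> Ck k UNIV (f i)) \<Longrightarrow> Ck k UNIV (\<lambda>x. \<Sum>i\<in>S. f i x)"
  by (induction S rule: infinite_finite_induct) (auto intro: Ck_const Ck_add)

lemma Ck_bounded_linear: "bounded_linear L \<Longrightarrow> Ck k UNIV f \<Longrightarrow> Ck k UNIV (\<lambda>x. L (f x))"
proof (induction k arbitrary: f)
  case 0
  then show ?case by (auto intro: bounded_linear.continuous_on)
next
  case (Suc k)
  show ?case
    by (rule Ck_SucI, rule bounded_linear.has_derivative[OF Suc.prems(1) Ck_has_derivative[OF Suc.prems(2)]])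
      (intro Suc.IH Suc.prems Ck_deriv[OF Suc.prems(2)])
qed

lemma Ck_mult:
  fixes f g :: "'a::euclidean_space \<Rightarrow> real"
  shows "Ck k UNIV f \<Longrightarrow> Ck k UNIV g \<Longrightarrow> Ck k UNIV (\<lambda>x. f x * g x)"
proof (induction k arbitrary: f g)
  case 0
  then show ?case by (auto intro: continuous_on_mult)
next
  case (Suc k)
  show ?case
    by (rule Ck_SucI, rule has_derivative_mult[OF Suc.prems[THEN Ck_has_derivative]])
      (intro Ck_add Suc.IH Suc.prems[THEN Ck_deriv] Suc.prems[THEN Ck_SucD])
qed

lemma Ck_prod:
  fixes f :: "'i \<Rightarrow> 'a::euclidean_space \<Rightarrow> real"
  shows "(\<And>i. i \<in> S \<Longrightarrow> Ck k UNIV (f i)) \<Longrightarrow> Ck k UNIV (\<lambda>x. \<Prod>i\<in>S. f i x)"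
  by (induction S rule: infinite_finite_induct) (auto intro: Ck_const Ck_mult)

text \<open>Negative exponents are included, so this covers reciprocals and square roots; the exponent must stay
  arbitrary in the induction, as differentiation lowers it by one.\<close>

lemma Ck_powr:
  fixes f :: "'a::euclidean_space \<Rightarrow> real"
  assumes "\<And>x. f x > 0" "Ck k UNIV f"
  shows "Ck k UNIV (\<lambda>x. f x powr a)"
  using assms(2)
proof (induction k arbitrary: a)
  case 0
  then show ?case using assms(1) by (auto intro!: continuous_intros simp: less_imp_neq[THEN not_sym])
next
  case (Suc k)
  have "((\<lambda>x. f x powr a) has_derivative
      (\<lambda>v. a * (f x powr (a - 1) * frechet_derivative f (at x) v))) (at x)" for x
    using DERIV_compose_FDERIV[OF has_real_derivative_powr[OF assms(1)] Ck_has_derivative[OF Suc.prems]]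
    by (simp add: mult_ac)
  then show ?case
    by (rule Ck_SucI)
      (intro Ck_mult Ck_const Suc.IH Ck_SucD[OF Suc.prems] Ck_deriv[OF Suc.prems])
qed

lemma Ck_vec:
  fixes f :: "'a::euclidean_space \<Rightarrow> real^'n::finite"
  assumes "\<And>i. Ck k UNIV (\<lambda>x. f x $ i)"
  shows "Ck k UNIV f"
proof -
  have "f = (\<lambda>x. \<Sum>i\<in>UNIV. f x $ i *\<^sub>R axis i 1)"
    by (auto simp: vec_eq_iff axis_def if_distrib if_distribR cong: if_cong)
  moreover have "Ck k UNIV (\<lambda>x. \<Sum>i\<in>UNIV. f x $ i *\<^sub>R (axis i 1 :: real^'n))"
    by (intro Ck_sum Ck_bounded_linear[OF bounded_linear_scaleR_left] assms)
  ultimately show ?thesis by simp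
qed

lemma Ck_det:
  fixes A :: "'a::euclidean_space \<Rightarrow> real^'n::finite^'n"
  assumes "\<And>i j. Ck k UNIV (\<lambda>x. A x $ i $ j)"
  shows "Ck k UNIV (\<lambda>x. det (A x))"
  unfolding det_def by (intro Ck_sum Ck_mult Ck_const Ck_prod assms)

lemma Ck_nth: "Ck k UNIV f \<Longrightarrow> Ck k UNIV (\<lambda>x. f x $ i)"
  by (rule Ck_bounded_linear[OF bounded_linear_vec_nth])

section \<open>A smooth unit normal field of an affine foliation\<close>

text \<open>The adjugate of \<open>A\<close> applied to \<open>q\<close>, in the form of the numerators of Cramer's rule. Up to a scalar it is
  the solution of \<open>A *v x = q\<close>, and unlike \<open>matrix_inv A *v q\<close> it is visibly polynomial in \<open>A\<close>.\<close>

definition adjugate_mult :: "real^'n^'n::finite \<Rightarrow> real^'n \<Rightarrow> real^'n" where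
  "adjugate_mult A q = (\<chi> k. det (\<chi> i j. if j = k then q $ i else A $ i $ j))"

text \<open>The covector \<open>q\<close> is raised with the metric \<open>A\<close> and normalised, which gives the unit normal of the
  hyperplane on which \<open>q\<close> vanishes.\<close>

definition unit_normal_vec :: "real^'n^'n::finite \<Rightarrow> real^'n \<Rightarrow> real^'n" where
  "unit_normal_vec A q = bform A (adjugate_mult A q) (adjugate_mult A q) powr (-1/2) *\<^sub>R adjugate_mult A q"

lemma mult_adjugate_mult:
  assumes "det A \<noteq> 0"
  shows "A *v adjugate_mult A q = det A *\<^sub>R q"
proof -
  have "A *v ((1 / det A) *\<^sub>R adjugate_mult A q) = q"
    using cramer[OF assms, of "(1 / det A) *\<^sub>R adjugate_mult A q" q]
    by (simp add: adjugate_mult_def vec_eq_iff)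
  then have "det A *\<^sub>R q = det A *\<^sub>R (1 / det A) *\<^sub>R (A *v adjugate_mult A q)"
    by (simp only: matrix_vector_mult_scaleR)
  then show ?thesis using assms by simp
qed

lemma unit_normal_vec:
  assumes A: "spd A" and q: "q \<noteq> 0"
  shows "bform A (unit_normal_vec A q) (unit_normal_vec A q) = 1"
    and "\<exists>t. t \<noteq> 0 \<and> A *v unit_normal_vec A q = t *\<^sub>R q"
proof -
  define w where "w = adjugate_mult A q"
  have d: "det A \<noteq> 0" using spd_det_nz[OF A] .
  have Aw: "A *v w = det A *\<^sub>R q" unfolding w_def by (rule mult_adjugate_mult[OF d])
  then have "w \<noteq> 0" using d q by auto
  then have b: "bform A w w > 0" using spd_pos[OF A] by blast
  then show "bform A (unit_normal_vec A q) (unit_normal_vec A q) = 1"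
    by (simp add: unit_normal_vec_def w_def[symmetric] powr_minus powr_half_sqrt field_simps)
  show "\<exists>t. t \<noteq> 0 \<and> A *v unit_normal_vec A q = t *\<^sub>R q"
    using b d by (intro exI[of _ "bform A w w powr (-1/2) * det A"])
      (simp add: unit_normal_vec_def w_def[symmetric] matrix_vector_mult_scaleR Aw)
qed

lemma Ck_adjugate_mult:
  assumes "Ck k UNIV G"
  shows "Ck k UNIV (\<lambda>x. adjugate_mult (G x) q)"
proof (rule Ck_vec)
  have ent: "Ck k UNIV (\<lambda>x. G x $ i $ j)" for i j by (intro Ck_nth assms)
  have *: "Ck k UNIV (\<lambda>x. if j = l then q $ i else G x $ i $ j)" for i j l
    using ent by (cases "j = l") (auto intro: Ck_const)
  show "Ck k UNIV (\<lambda>x. adjugate_mult (G x) q $ l)" for l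
    unfolding adjugate_mult_def vec_lambda_beta by (rule Ck_det) (simp only: vec_lambda_beta *)
qed

lemma Ck_unit_normal_vec:
  assumes G: "Ck k UNIV G" and pd: "\<And>x. spd (G x)" and q: "q \<noteq> 0"
  shows "Ck k UNIV (\<lambda>x. unit_normal_vec (G x) q)"
proof (rule Ck_vec)
  have adj: "Ck k UNIV (\<lambda>x. adjugate_mult (G x) q $ i)" for i by (intro Ck_nth Ck_adjugate_mult G)
  have "Ck k UNIV (\<lambda>x. bform (G x) (adjugate_mult (G x) q) (adjugate_mult (G x) q))"
    unfolding bform_eq_sum by (intro Ck_sum Ck_mult adj Ck_nth G)
  moreover have "bform (G x) (adjugate_mult (G x) q) (adjugate_mult (G x) q) > 0" for x
  proof -
    have "det (G x) \<noteq> 0" by (rule spd_det_nz[OF pd])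
    then have "adjugate_mult (G x) q \<noteq> 0" using mult_adjugate_mult[of "G x" q] q by auto
    then show ?thesis using spd_pos[OF pd] by blast
  qed
  ultimately show "Ck k UNIV (\<lambda>x. unit_normal_vec (G x) q $ i)" for i
    unfolding unit_normal_vec_def vector_scaleR_component real_scaleR_def
    by (intro Ck_mult Ck_powr adj)
qed

section \<open>The second fundamental form in terms of the derivative of the metric\<close>

definition lift :: "('n::finite torus \<Rightarrow> 'b) \<Rightarrow> real^'n \<Rightarrow> 'b" where
  "lift f = f \<circ> abs_torus"

lemma lift_rep [simp]: "lift f (rep_torus x) = f x"
  by (simp add: lift_def Quotient_abs_rep[OF Quotient_torus])

lemma gprod_bform: "gprod g x = bform (g x)"
  by (simp add: gprod_def bform_def fun_eq_iff)

lemma metric_spd: "riemannian_metric g \<Longrightarrow> spd (g x)"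
  by (simp add: riemannian_metric_def gprod_bform spd_def)

lemma metric_Ck: "riemannian_metric g \<Longrightarrow> Ck k UNIV (lift g)"
  by (simp add: riemannian_metric_def torus_smooth_on_def smooth_on_def lift_def)

abbreviation dmetric :: "'n::finite metric \<Rightarrow> 'n torus \<Rightarrow> real^'n \<Rightarrow> real^'n^'n" where
  "dmetric g \<equiv> torus_deriv g"

lemma torus_has_derivative:
  assumes "Ck (Suc 0) UNIV (lift f)"
  shows "(lift f has_derivative torus_deriv f x) (at (rep_torus x))"
proof -
  have "torus_deriv f x = frechet_derivative (lift f) (at (rep_torus x))"
    by (simp add: torus_deriv_def lift_def fun_eq_iff)
  then show ?thesis using Ck_has_derivative[OF assms] by simp
qed

lemma metric_has_derivative:
  assumes "riemannian_metric g"
  shows "(lift g has_derivative dmetric g x) (at (rep_torus x))"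
  by (rule torus_has_derivative[OF metric_Ck[OF assms]])

lemma bounded_linear_matrix_vector_left:
  "bounded_linear (\<lambda>A :: real^'n::finite^'n. A *v v)"
  by (auto simp: linear_conv_bounded_linear[symmetric] matrix_vector_mult_add_rdistrib
      scaleR_matrix_vector_assoc intro!: linearI)

lemma linear_dmetric: "riemannian_metric g \<Longrightarrow> linear (dmetric g x)"
  using metric_has_derivative has_derivative_linear by blast

lemma torus_deriv_eqI:
  assumes "(lift f has_derivative D) (at (rep_torus x))"
  shows "torus_deriv f x = D"
  using frechet_derivative_at[OF assms] by (simp add: torus_deriv_def lift_def fun_eq_iff)

lemma torus_deriv_entry:
  assumes "riemannian_metric g"
  shows "torus_deriv (\<lambda>y. g y $ i $ j) x v = dmetric g x v $ i $ j"
proof -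
  have "(lift (\<lambda>y. g y $ i $ j) has_derivative (\<lambda>v. dmetric g x v $ i $ j)) (at (rep_torus x))"
    using bounded_linear.has_derivative[OF bounded_linear_vec_nth
        bounded_linear.has_derivative[OF bounded_linear_vec_nth metric_has_derivative[OF assms]]]
    by (simp add: lift_def o_def)
  then show ?thesis by (simp add: torus_deriv_eqI)
qed

lemma dmetric_sym:
  assumes "riemannian_metric g"
  shows "bform (dmetric g x u) v w = bform (dmetric g x u) w v"
proof -
  have d: "((\<lambda>y. bform (lift g y) v w) has_derivative (\<lambda>u. bform (dmetric g x u) v w)) (at (rep_torus x))" for v w
    unfolding bform_def
    by (intro bounded_linear.has_derivative[OF bounded_linear_inner_right]
        bounded_linear.has_derivative[OF bounded_linear_matrix_vector_left]
        metric_has_derivative assms)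
  have "(\<lambda>y. bform (lift g y) v w) = (\<lambda>y. bform (lift g y) w v)"
    using spd_sym[OF metric_spd[OF assms]] by (auto simp: lift_def)
  then have "(\<lambda>u. bform (dmetric g x u) v w) = (\<lambda>u. bform (dmetric g x u) w v)"
    using d[of v w] d[of w v] has_derivative_unique by metis
  then show ?thesis by meson
qed

lemma linear_axis_expand:
  fixes T :: "real^'n::finite \<Rightarrow> real^'n^'n"
  assumes "linear T"
  shows "T v $ j $ l = (\<Sum>i\<in>UNIV. v $ i * T (axis i 1) $ j $ l)"
proof -
  have "v = (\<Sum>i\<in>UNIV. v $ i *\<^sub>R axis i 1)"
    by (auto simp: vec_eq_iff axis_def if_distrib if_distribR cong: if_cong)
  then have "T v = T (\<Sum>i\<in>UNIV. v $ i *\<^sub>R axis i 1)" by simp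
  also have "\<dots> = (\<Sum>i\<in>UNIV. v $ i *\<^sub>R T (axis i 1))"
    by (simp add: linear_sum[OF assms] linear_cmul[OF assms])
  finally show ?thesis by simp
qed

text \<open>Lowering the upper index of the Christoffel symbols cancels the inverse metric. What remains is the Koszul
  formula for vector fields with constant coefficients.\<close>

lemma christoffel_form:
  assumes g: "riemannian_metric g"
  shows "bform (g x) (\<chi> k. \<Sum>i\<in>UNIV. \<Sum>j\<in>UNIV. christoffel g k i j x * v $ i * w $ j) u
    = (bform (dmetric g x v) w u + bform (dmetric g x w) v u - bform (dmetric g x u) v w) / 2"
proof -
  let ?D = "\<lambda>i. dmetric g x (axis i 1)"
  define C where "C = (\<lambda>l i j. ?D i $ j $ l + ?D j $ i $ l - ?D l $ i $ j)"
  define c where "c = (\<chi> l. \<Sum>i\<in>UNIV. \<Sum>j\<in>UNIV. (1/2) * C l i j * v $ i * w $ j)"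
  have chr: "christoffel g k i j x = (\<Sum>l\<in>UNIV. matrix_inv (g x) $ k $ l * ((1/2) * C l i j))" for k i j
    by (simp add: christoffel_def torus_deriv_entry[OF g] C_def sum_distrib_left mult_ac)
  have "(\<Sum>i\<in>UNIV. \<Sum>j\<in>UNIV. christoffel g k i j x * v $ i * w $ j) = (matrix_inv (g x) *v c) $ k" for k
  proof -
    have "(matrix_inv (g x) *v c) $ k
       = (\<Sum>l\<in>UNIV. \<Sum>i\<in>UNIV. \<Sum>j\<in>UNIV. matrix_inv (g x) $ k $ l * ((1/2) * C l i j) * v $ i * w $ j)"
      by (simp add: matrix_vector_mult_def c_def sum_distrib_left mult_ac)
    also have "\<dots> = (\<Sum>i\<in>UNIV. \<Sum>l\<in>UNIV. \<Sum>j\<in>UNIV. matrix_inv (g x) $ k $ l * ((1/2) * C l i j) * v $ i * w $ j)"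
      by (rule sum.swap)
    also have "\<dots> = (\<Sum>i\<in>UNIV. \<Sum>j\<in>UNIV. \<Sum>l\<in>UNIV. matrix_inv (g x) $ k $ l * ((1/2) * C l i j) * v $ i * w $ j)"
      by (intro sum.cong refl sum.swap)
    finally show ?thesis by (simp only: chr sum_distrib_right)
  qed
  then have "(\<chi> k. \<Sum>i\<in>UNIV. \<Sum>j\<in>UNIV. christoffel g k i j x * v $ i * w $ j) = matrix_inv (g x) *v c"
    by (simp add: vec_eq_iff)
  moreover have "bform (g x) (matrix_inv (g x) *v c) u = u \<bullet> c"
  proof -
    have "g x ** matrix_inv (g x) = mat 1"
      using someI_ex[OF spd_invertible[OF metric_spd[OF g], of x, unfolded invertible_def]]
      unfolding matrix_inv_def by (rule conjunct1)
    then have "g x *v (matrix_inv (g x) *v c) = c"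
      by (simp only: matrix_vector_mul_assoc matrix_vector_mul_lid)
    then show ?thesis
      by (subst spd_sym[OF metric_spd[OF g]]) (simp only: bform_def)
  qed
  moreover have "u \<bullet> c = (bform (dmetric g x v) w u + bform (dmetric g x w) v u - bform (dmetric g x u) v w) / 2"
  proof -
    note lin = linear_axis_expand[OF linear_dmetric[OF g], of x]
    have 1: "bform (dmetric g x v) w u = (\<Sum>l\<in>UNIV. \<Sum>i\<in>UNIV. \<Sum>j\<in>UNIV. ?D i $ j $ l * u $ l * v $ i * w $ j)"
      unfolding bform_eq_sum lin[of v]
      by (simp add: sum_distrib_left sum_distrib_right mult_ac)
        (subst sum.swap, intro sum.cong refl sum.swap)
    have 2: "bform (dmetric g x w) v u = (\<Sum>l\<in>UNIV. \<Sum>i\<in>UNIV. \<Sum>j\<in>UNIV. ?D j $ i $ l * u $ l * v $ i * w $ j)"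
      unfolding bform_eq_sum lin[of w]
      by (simp add: sum_distrib_left sum_distrib_right mult_ac)
        (subst sum.swap, intro sum.cong refl)
    have 3: "bform (dmetric g x u) v w = (\<Sum>l\<in>UNIV. \<Sum>i\<in>UNIV. \<Sum>j\<in>UNIV. ?D l $ i $ j * u $ l * v $ i * w $ j)"
    proof -
      have "bform (dmetric g x u) v w = (\<Sum>i\<in>UNIV. \<Sum>j\<in>UNIV. \<Sum>l\<in>UNIV. ?D l $ i $ j * u $ l * v $ i * w $ j)"
        unfolding bform_eq_sum lin[of u]
        by (simp add: sum_distrib_left sum_distrib_right mult_ac)
      also have "\<dots> = (\<Sum>i\<in>UNIV. \<Sum>l\<in>UNIV. \<Sum>j\<in>UNIV. ?D l $ i $ j * u $ l * v $ i * w $ j)"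
        by (intro sum.cong refl sum.swap)
      also have "\<dots> = (\<Sum>l\<in>UNIV. \<Sum>i\<in>UNIV. \<Sum>j\<in>UNIV. ?D l $ i $ j * u $ l * v $ i * w $ j)"
        by (rule sum.swap)
      finally show ?thesis .
    qed
    have "u \<bullet> c = (\<Sum>l\<in>UNIV. \<Sum>i\<in>UNIV. \<Sum>j\<in>UNIV. (1/2) * C l i j * u $ l * v $ i * w $ j)"
      by (simp add: inner_vec_def c_def sum_distrib_left mult_ac)
    also have "\<dots> = (1/2) * (\<Sum>l\<in>UNIV. \<Sum>i\<in>UNIV. \<Sum>j\<in>UNIV. ?D i $ j $ l * u $ l * v $ i * w $ j
        + ?D j $ i $ l * u $ l * v $ i * w $ j - ?D l $ i $ j * u $ l * v $ i * w $ j)"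
      by (simp add: C_def sum_distrib_left algebra_simps)
    also have "\<dots> = (1/2) * (bform (dmetric g x v) w u + bform (dmetric g x w) v u - bform (dmetric g x u) v w)"
      unfolding 1 2 3 by (simp only: sum.distrib sum_subtractf)
    finally show ?thesis by simp
  qed
  ultimately show ?thesis by simp
qed

text \<open>Differentiating \<open>bform (g y) (N y) e = 0\<close> in the constant direction \<open>e\<close> trades the derivative of \<open>N\<close>
  for one of the metric. This is why the leaves of affine foliations are easy to handle: \<open>e\<close> stays tangent
  to the leaves on the whole torus.\<close>

lemma second_fundamental_form_eq:
  assumes g: "riemannian_metric g" and N: "Ck (Suc 0) UNIV (lift N)"
    and orth: "\<And>y. bform (g y) (N y) e = 0"
  shows "second_fundamental_form g N x e e
    = bform (dmetric g x e) (N x) e - bform (dmetric g x (N x)) e e / 2"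
proof -
  let ?X = "rep_torus x"
  have dN: "(lift N has_derivative torus_deriv N x) (at ?X)"
    by (rule torus_has_derivative[OF N])
  have "((\<lambda>y. lift N y \<bullet> (lift g y *v e)) has_derivative
      (\<lambda>h. lift N ?X \<bullet> (dmetric g x h *v e) + torus_deriv N x h \<bullet> (lift g ?X *v e))) (at ?X)"
    by (intro has_derivative_inner dN bounded_linear.has_derivative[OF bounded_linear_matrix_vector_left]
        metric_has_derivative g)
  moreover have "(\<lambda>y. lift N y \<bullet> (lift g y *v e)) = (\<lambda>_. 0)"
    using orth by (simp add: lift_def bform_def)
  ultimately have "(\<lambda>h. lift N ?X \<bullet> (dmetric g x h *v e) + torus_deriv N x h \<bullet> (lift g ?X *v e)) = (\<lambda>_. 0)"
    using has_derivative_unique[OF _ has_derivative_const[of 0]] by simp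
  from fun_cong[OF this, of e]
  have "bform (dmetric g x e) (N x) e + bform (g x) (torus_deriv N x e) e = 0"
    by (simp add: bform_def)
  moreover have "second_fundamental_form g N x e e = - (bform (g x) (torus_deriv N x e) e
      + (bform (dmetric g x e) (N x) e + bform (dmetric g x (N x)) e e - bform (dmetric g x e) e (N x)) / 2)"
    by (simp only: second_fundamental_form_def cov_deriv_def gprod_bform bform_simps(1)
        christoffel_form[OF g])
  moreover have "bform (dmetric g x e) e (N x) = bform (dmetric g x e) (N x) e"
    by (rule dmetric_sym[OF g])
  ultimately show ?thesis by simp
qed

lemma primitive_nonzero:
  fixes p :: "int^'n::finite"
  assumes "primitive p"
  shows "(\<chi> i. real_of_int (p $ i)) \<noteq> 0"
proof
  assume "(\<chi> i. real_of_int (p $ i)) = 0"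
  then have "p $ i = 0" for i by (simp add: vec_eq_iff)
  then have "range (($) p) = {0}" by auto
  then show False using assms by (simp add: primitive_def)
qed

text \<open>The one-form \<open>g\<^sup>i\<^sup>j \<Gamma>\<^sub>k\<^sub>i\<^sub>j\<close>, with all indices of the Christoffel symbol lowered and the contraction
  written as a sum over the orthonormal basis \<open>E\<close>.\<close>

definition contracted_christoffel :: "'n::finite metric \<Rightarrow> 'n torus \<Rightarrow> (real^'n) set \<Rightarrow> real^'n \<Rightarrow> real" where
  "contracted_christoffel g x E v = (\<Sum>e\<in>E. bform (dmetric g x e) v e - bform (dmetric g x v) e e / 2)"

text \<open>The mean curvature is the sum of \<open>dg\<^sub>e(N, e) - dg\<^sub>N(e, e) / 2\<close> over an orthonormal basis of the tangent
  hyperplane. Adjoining \<open>N\<close> to that basis adds \<open>dg\<^sub>N(N, N) / 2\<close>, so minimality turns into an identity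
  between a trace over the full tangent space and a cubic expression in \<open>N\<close>.\<close>

lemma minimal_leaf_normal:
  assumes g: "riemannian_metric g" and p: "primitive p"
    and min: "\<And>s. minimal_hypersurface g (leaf p s)"
  defines "q \<equiv> (\<chi> i. real_of_int (p $ i))"
  shows "\<exists>E. orthonormal_wrt (g x) E \<and> span E = UNIV \<and>
     (let N = unit_normal_vec (g x) q in bform (dmetric g x N) N N = 2 * contracted_christoffel g x E N)"
proof -
  have q0: "q \<noteq> 0" unfolding q_def by (rule primitive_nonzero[OF p])
  note pd = metric_spd[OF g]
  define s where "s = torus_pairing p x"
  have xs: "x \<in> leaf p s" by (simp add: leaf_def s_def)
  define N where "N = (\<lambda>y. unit_normal_vec (g y) q)"
  have lN: "lift N = (\<lambda>y. unit_normal_vec (lift g y) q)" by (simp add: lift_def N_def o_def)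
  have smN: "Ck k UNIV (lift N)" for k
    unfolding lN by (rule Ck_unit_normal_vec[OF metric_Ck[OF g] _ q0]) (simp add: lift_def pd)
  have N1: "bform (g y) (N y) (N y) = 1" for y
    unfolding N_def by (rule unit_normal_vec(1)[OF pd q0])
  have perp: "bform (g y) (N y) v = 0 \<longleftrightarrow> q \<bullet> v = 0" for y v
  proof -
    obtain t where "t \<noteq> 0" "g y *v N y = t *\<^sub>R q"
      using unit_normal_vec(2)[OF pd q0] unfolding N_def by blast
    then have "bform (g y) v (N y) = 0 \<longleftrightarrow> q \<bullet> v = 0" by (simp add: bform_def inner_commute)
    then show ?thesis using spd_sym[OF pd] by metis
  qed
  define V where "V = {v. q \<bullet> v = 0}"
  have tan: "tangent_space (leaf p s) y = V" if "y \<in> leaf p s" for y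
    unfolding V_def q_def by (rule tangent_space_leaf[OF that])
  have "unit_normal_field g (leaf p s) UNIV N"
    using smN N1 perp tan
    by (auto simp: unit_normal_field_def torus_smooth_on_def smooth_on_def lift_def gprod_bform V_def)
  then have mc: "mean_curvature g (leaf p s) N x = 0"
    using min[of s] xs by (simp add: minimal_hypersurface_def)
  define B where "B = (SOME B. orthonormal_basis g x V B)"
  have onb: "orthonormal_basis g x V B \<longleftrightarrow> orthonormal_wrt (g x) B \<and> span B = V" for B
    unfolding orthonormal_basis_def orthonormal_wrt_def gprod_bform by (rule conj_commute)
  have "subspace V" by (auto simp: V_def subspace_def inner_add_right)
  then have sV: "span V = V" by (simp only: span_eq_iff)
  have "\<exists>B. orthonormal_basis g x V B"
    using orthonormal_basis_exists[OF pd, of x V] unfolding onb sV .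
  then have "orthonormal_basis g x V B" unfolding B_def by (rule someI_ex)
  then have B: "orthonormal_wrt (g x) B" "span B = V"
    unfolding onb by auto
  note fin = orthonormal_wrt_finite[OF B(1)]
  have BV: "bform (g y) (N y) e = 0" if "e \<in> B" for e y
  proof -
    have "e \<in> V" using span_base[OF that] B(2) by simp
    then show ?thesis by (simp add: perp V_def)
  qed
  have NB: "N x \<notin> B" using BV[of "N x" x] N1[of x] by auto
  define E where "E = insert (N x) B"
  have "orthonormal_wrt (g x) E"
  proof -
    have "bform (g x) e (N x) = 0" if "e \<in> B" for e
      using BV[OF that, of x] spd_sym[OF pd] by metis
    then show ?thesis
      using B(1) BV[of _ x] N1[of x] NB by (auto simp: orthonormal_wrt_def E_def)
  qed
  moreover have "span E = UNIV"
  proof -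
    have "v \<in> span E" for v
    proof -
      define d where "d = v - bform (g x) (N x) v *\<^sub>R N x"
      have "bform (g x) (N x) d = 0" using N1 by (simp add: d_def)
      then have "d \<in> span B" unfolding B(2) V_def perp by simp
      then have "d \<in> span E" using span_mono[of B E] unfolding E_def by blast
      moreover have "bform (g x) (N x) v *\<^sub>R N x \<in> span E"
        by (intro span_scale span_base) (simp add: E_def)
      ultimately have "d + bform (g x) (N x) v *\<^sub>R N x \<in> span E" by (rule span_add)
      then show ?thesis by (simp add: d_def)
    qed
    then show ?thesis by blast
  qed
  moreover have "bform (dmetric g x (N x)) (N x) (N x) = 2 * contracted_christoffel g x E (N x)"
  proof -
    have "mean_curvature g (leaf p s) N x
       = (\<Sum>e\<in>B. bform (dmetric g x e) (N x) e - bform (dmetric g x (N x)) e e / 2)"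
      unfolding mean_curvature_def tan[OF xs] B_def[symmetric]
      by (intro sum.cong refl second_fundamental_form_eq[OF g smN] BV)
    then have "(\<Sum>e\<in>B. bform (dmetric g x e) (N x) e - bform (dmetric g x (N x)) e e / 2) = 0"
      using mc by simp
    then show ?thesis using fin NB by (simp add: contracted_christoffel_def E_def)
  qed
  ultimately have "orthonormal_wrt (g x) E \<and> span E = UNIV \<and>
     (let N = N x in bform (dmetric g x N) N N = 2 * contracted_christoffel g x E N)"
    by (simp only: Let_def simp_thms)
  then show ?thesis unfolding N_def by (rule exI)
qed

section \<open>The cubic identity at a point\<close>

lemma tendsto_bform:
  fixes D :: "'a \<Rightarrow> real^'n::finite^'n"
  assumes "(D \<longlongrightarrow> D0) F" "(v \<longlongrightarrow> v0) F" "(w \<longlongrightarrow> w0) F"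
  shows "((\<lambda>k. bform (D k) (v k) (w k)) \<longlongrightarrow> bform D0 v0 w0) F"
  unfolding bform_eq_sum by (intro tendsto_intros assms)

lemma contracted_christoffel_linear:
  assumes "riemannian_metric g"
  shows "linear (contracted_christoffel g x E)"
  using linear_dmetric[OF assms, of x]
  by (intro linearI)
    (simp_all add: contracted_christoffel_def linear_add linear_cmul sum.distrib sum_subtractf sum_distrib_left algebra_simps
      add_divide_distrib flip: sum_divide_distrib)

lemma contracted_christoffel_basis_independent:
  assumes g: "riemannian_metric g"
    and "orthonormal_wrt (g x) E" "span E = UNIV" "orthonormal_wrt (g x) F" "span F = UNIV"
  shows "contracted_christoffel g x E = contracted_christoffel g x F"
proof
  fix v
  have "bilinear (\<lambda>a b. bform (dmetric g x a) v b - bform (dmetric g x v) a b / 2)"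
    unfolding bilinear_def using linear_dmetric[OF g, of x]
    by (auto intro!: linearI simp: linear_add linear_cmul algebra_simps add_divide_distrib)
  from trace_basis_independent[OF metric_spd[OF g] assms(2-5) this]
  show "contracted_christoffel g x E v = contracted_christoffel g x F v" by (simp add: contracted_christoffel_def)
qed

lemma primitive_multiple:
  fixes q :: "int^'n::finite"
  assumes "q \<noteq> 0"
  obtains d p where "primitive p" "\<And>i. q $ i = d * p $ i"
proof -
  define d where "d = Gcd (range (($) q))"
  define p :: "int^'n" where "p = (\<chi> i. q $ i div d)"
  obtain i0 where "q $ i0 \<noteq> 0" using assms by (auto simp: vec_eq_iff)
  moreover have dv: "d dvd q $ i" for i unfolding d_def by (rule Gcd_dvd) simp
  ultimately have d0: "d \<noteq> 0" by (metis dvd_0_left)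
  have qp: "q $ i = d * p $ i" for i using dv[of i] by (simp add: p_def)
  then have "range (($) q) = (*) d ` range (($) p)" by (auto simp: image_iff)
  then have "d = normalize (d * Gcd (range (($) p)))" by (metis Gcd_mult d_def)
  then have "\<bar>d\<bar> = \<bar>d\<bar> * Gcd (range (($) p))" by (simp add: abs_mult) (metis abs_abs abs_mult Gcd_int_greater_eq_0 abs_of_nonneg)
  then have "primitive p" using d0 by (simp add: primitive_def)
  then show ?thesis using qp that by blast
qed

lemma floor_mult_div_tendsto:
  fixes a :: real
  shows "(\<lambda>k. of_int \<lfloor>real (Suc k) * a\<rfloor> / real (Suc k)) \<longlonglongrightarrow> a"
proof (rule real_tendsto_sandwich)
  show "(\<lambda>k. a - inverse (real (Suc k))) \<longlonglongrightarrow> a"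
    using tendsto_diff[OF tendsto_const LIMSEQ_inverse_real_of_nat, of a] by simp
  have "of_int \<lfloor>real (Suc k) * a\<rfloor> \<le> a * real (Suc k)" for k
    using of_int_floor_le[of "real (Suc k) * a"] by (simp add: mult.commute)
  then show "\<forall>\<^sub>F k in sequentially. of_int \<lfloor>real (Suc k) * a\<rfloor> / real (Suc k) \<le> a"
    by (intro always_eventually allI) (simp add: divide_le_eq del: of_nat_Suc)
  have "a - inverse (real (Suc k)) \<le> of_int \<lfloor>real (Suc k) * a\<rfloor> / real (Suc k)" for k
  proof -
    have "(a - inverse (real (Suc k))) * real (Suc k) = real (Suc k) * a - 1"
      by (simp add: left_diff_distrib del: of_nat_Suc)
    also have "\<dots> \<le> of_int \<lfloor>real (Suc k) * a\<rfloor>" by linarith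
    finally have "(a - inverse (real (Suc k))) * real (Suc k) \<le> of_int \<lfloor>real (Suc k) * a\<rfloor>" .
    then show ?thesis by (simp add: le_divide_eq del: of_nat_Suc)
  qed
  then show "\<forall>\<^sub>F k in sequentially. a - inverse (real (Suc k)) \<le> of_int \<lfloor>real (Suc k) * a\<rfloor> / real (Suc k)"
    by simp
qed auto

text \<open>For \<open>g\<close>-dual vectors of primitive covectors, this is the minimality of the leaves. Both sides are homogeneous
  of degree three in \<open>v\<close>, so it extends to the duals of real multiples of integer covectors, and by
  density to all \<open>v\<close>.\<close>

lemma minimal_leaves_cubic_identity:
  fixes g :: "'n::finite metric"
  assumes g: "riemannian_metric g"
    and min: "\<And>(p :: int^'n) s. primitive p \<Longrightarrow> minimal_hypersurface g (leaf p s)"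
    and E: "orthonormal_wrt (g x) E" "span E = UNIV"
  shows "bform (dmetric g x v) v v = 2 * contracted_christoffel g x E v * bform (g x) v v"
proof -
  note pd = metric_spd[OF g, of x]
  note linD = linear_dmetric[OF g, of x] and lind = contracted_christoffel_linear[OF g, of x E]
  obtain A' where A': "g x ** A' = mat 1" "A' ** g x = mat 1"
    using spd_invertible[OF pd] by (auto simp: invertible_def)
  have scal: "bform (dmetric g x (r *\<^sub>R w)) (r *\<^sub>R w) (r *\<^sub>R w)
      = 2 * contracted_christoffel g x E (r *\<^sub>R w) * bform (g x) (r *\<^sub>R w) (r *\<^sub>R w)"
    if "bform (dmetric g x w) w w = 2 * contracted_christoffel g x E w * bform (g x) w w" for r w
    using that by (simp add: linear_cmul[OF linD] linear_cmul[OF lind])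
  have int: "bform (dmetric g x w) w w = 2 * contracted_christoffel g x E w * bform (g x) w w"
    if w: "w = r *\<^sub>R (A' *v (\<chi> i. real_of_int (q $ i)))" for r w and q :: "int^'n"
  proof (cases "q = 0")
    case True
    then have "w = 0" using w by (simp add: vec_eq_iff matrix_vector_mult_def)
    then show ?thesis by simp
  next
    case False
    then obtain d p where p: "primitive p" and qp: "\<And>i. q $ i = d * p $ i"
      using primitive_multiple by blast
    define p' :: "real^'n" where "p' = (\<chi> i. real_of_int (p $ i))"
    define N where "N = unit_normal_vec (g x) p'"
    have p0: "p' \<noteq> 0" unfolding p'_def by (rule primitive_nonzero[OF p])
    obtain F where F: "orthonormal_wrt (g x) F" "span F = UNIV"
      and N: "bform (dmetric g x N) N N = 2 * contracted_christoffel g x F N"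
      using minimal_leaf_normal[OF g p min[OF p], of x] unfolding Let_def N_def p'_def by blast
    have "bform (dmetric g x N) N N = 2 * contracted_christoffel g x E N * bform (g x) N N"
      using N unit_normal_vec(1)[OF pd p0] contracted_christoffel_basis_independent[OF g F E]
      by (simp add: N_def)
    moreover obtain t where t: "t \<noteq> 0" "g x *v N = t *\<^sub>R p'"
      using unit_normal_vec(2)[OF pd p0] unfolding N_def by blast
    have "w = (r * d / t) *\<^sub>R N"
    proof -
      have "N = A' *v (g x *v N)" by (simp add: matrix_vector_mul_assoc A')
      then have "N = t *\<^sub>R (A' *v p')" by (simp add: t matrix_vector_mult_scaleR)
      moreover have "(\<chi> i. real_of_int (q $ i)) = real_of_int d *\<^sub>R p'"
        by (simp add: vec_eq_iff p'_def qp)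
      then have "w = (r * d) *\<^sub>R (A' *v p')" by (simp add: w matrix_vector_mult_scaleR)
      ultimately show ?thesis using t(1) by simp
    qed
    ultimately show ?thesis using scal by blast
  qed
  \<comment> \<open>The rational covectors \<open>qk k / (k + 1)\<close> approximate the dual \<open>c\<close> of \<open>v\<close>.\<close>
  define c where "c = g x *v v"
  define qk :: "nat \<Rightarrow> int^'n" where "qk k = (\<chi> i. \<lfloor>real (Suc k) * c $ i\<rfloor>)" for k
  define vk where "vk k = (1 / real (Suc k)) *\<^sub>R (A' *v (\<chi> i. real_of_int (qk k $ i)))" for k
  have "vk = (\<lambda>k. A' *v (\<chi> i. of_int \<lfloor>real (Suc k) * c $ i\<rfloor> / real (Suc k)))"
  proof
    fix k
    have "(\<chi> i. of_int \<lfloor>real (Suc k) * c $ i\<rfloor> / real (Suc k)) = (1 / real (Suc k)) *\<^sub>R (\<chi> i. real_of_int (qk k $ i))"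
      by (simp add: vec_eq_iff qk_def del: of_nat_Suc)
    then show "vk k = A' *v (\<chi> i. of_int \<lfloor>real (Suc k) * c $ i\<rfloor> / real (Suc k))"
      by (simp only: vk_def matrix_vector_mult_scaleR)
  qed
  moreover have "(\<lambda>k. A' *v (\<chi> i. of_int \<lfloor>real (Suc k) * c $ i\<rfloor> / real (Suc k))) \<longlonglongrightarrow> A' *v c"
    by (intro bounded_linear.tendsto[OF matrix_vector_mul_bounded_linear] vec_tendstoI)
      (simp only: vec_lambda_beta floor_mult_div_tendsto)
  moreover have "A' *v c = v" by (simp add: c_def matrix_vector_mul_assoc A')
  ultimately have vk: "vk \<longlonglongrightarrow> v" by simp
  have D: "(\<lambda>k. dmetric g x (vk k)) \<longlonglongrightarrow> dmetric g x v"
    by (rule bounded_linear.tendsto[OF _ vk]) (use linD linear_conv_bounded_linear in blast)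
  have d: "(\<lambda>k. contracted_christoffel g x E (vk k)) \<longlonglongrightarrow> contracted_christoffel g x E v"
    by (rule bounded_linear.tendsto[OF _ vk]) (use lind linear_conv_bounded_linear in blast)
  have "(\<lambda>k. bform (dmetric g x (vk k)) (vk k) (vk k)) \<longlonglongrightarrow> bform (dmetric g x v) v v"
    by (intro tendsto_bform D vk)
  moreover have "(\<lambda>k. 2 * contracted_christoffel g x E (vk k) * bform (g x) (vk k) (vk k)) \<longlonglongrightarrow> 2 * contracted_christoffel g x E v * bform (g x) v v"
    by (intro tendsto_intros tendsto_bform d vk)
  moreover have "bform (dmetric g x (vk k)) (vk k) (vk k) = 2 * contracted_christoffel g x E (vk k) * bform (g x) (vk k) (vk k)" for k
    by (rule int) (rule vk_def)
  ultimately show ?thesis by (simp add: LIMSEQ_unique)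
qed

text \<open>The idea is to polarise the cubic identity to
  \<open>D\<^sub>v(u, u) + 2 D\<^sub>u(v, u) = 2 l(v) A(u, u) + 4 l(u) A(v, u)\<close> and to sum over \<open>u\<close> in an orthonormal basis.
  With \<open>\<tau>(v)\<close> the trace of \<open>D\<^sub>v\<close>, the left-hand side becomes \<open>\<tau>(v) + (2 l(v) + \<tau>(v))\<close> by the formula
  for \<open>l\<close>, and the right-hand side becomes \<open>(2n + 4) l(v)\<close>.\<close>

lemma cubic_identity_trace:
  fixes A :: "real^'n::finite^'n" and D :: "real^'n \<Rightarrow> real^'n^'n"
  assumes A: "spd A" and E: "orthonormal_wrt A E" "span E = UNIV"
    and D: "linear D" and sym: "\<And>u v w. bform (D u) v w = bform (D u) w v"
    and l: "linear l" and leq: "\<And>v. l v = (\<Sum>e\<in>E. bform (D e) v e - bform (D v) e e / 2)"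
    and cub: "\<And>v. bform (D v) v v = 2 * l v * bform A v v"
  shows "(\<Sum>e\<in>E. bform (D v) e e) = (real CARD('n) + 1) * l v"
proof -
  have pol: "bform (D v) u u + 2 * bform (D u) v u = 2 * (l v * bform A u u + 2 * (l u * bform A v u))" for u v
  proof -
    have eq: "bform (D u) u v = bform (D u) v u" "bform (D v) u v = bform (D v) v u" "bform A u v = bform A v u"
      using sym spd_sym[OF A] by blast+
    show ?thesis
      using cub[of "v + u"] cub[of "v - u"] cub[of v]
      by (simp add: linear_add[OF D] linear_diff[OF D] linear_add[OF l] linear_diff[OF l] eq algebra_simps)
  qed
  have "(\<Sum>e\<in>E. l e * bform A v e) = l (\<Sum>e\<in>E. bform A v e *\<^sub>R e)"
    by (simp add: linear_sum[OF l] linear_cmul[OF l] mult.commute)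
  also have "\<dots> = l v" using orthonormal_expansion[OF A E(1), of v] E(2) by simp
  finally have 1: "(\<Sum>e\<in>E. l e * bform A v e) = l v" .
  have "(\<Sum>e\<in>E. bform A e e) = (\<Sum>e\<in>E. 1)"
    using E(1) by (intro sum.cong) (auto simp: orthonormal_wrt_def)
  then have 2: "(\<Sum>e\<in>E. bform A e e) = CARD('n)"
    by (simp add: orthonormal_wrt_card[OF E])
  have "(\<Sum>e\<in>E. bform (D v) e e + 2 * bform (D e) v e)
      = (\<Sum>e\<in>E. 2 * (l v * bform A e e + 2 * (l e * bform A v e)))"
    by (simp only: pol)
  also have "\<dots> = 2 * (l v * CARD('n) + 2 * l v)"
    by (simp only: sum.distrib sum_distrib_left[symmetric] 1 2)
  finally have "(\<Sum>e\<in>E. bform (D v) e e) + 2 * (\<Sum>e\<in>E. bform (D e) v e) = 2 * (l v * CARD('n) + 2 * l v)"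
    by (simp add: sum.distrib sum_distrib_left mult.commute)
  moreover have "l v = (\<Sum>e\<in>E. bform (D e) v e) - (\<Sum>e\<in>E. bform (D v) e e) / 2"
    by (simp add: leq sum_subtractf sum_divide_distrib)
  moreover have "t = c * s + s" if "t + 2 * b = 2 * (s * c + 2 * s)" "s = b - t / 2" for t b c s :: real
  proof -
    have "b = s + t / 2" using that(2) by simp
    with that(1) have "t + 2 * (s + t / 2) = 2 * (s * c + 2 * s)" by (simp only:)
    then show ?thesis by (simp add: algebra_simps)
  qed
  ultimately show ?thesis unfolding distrib_right mult_1 by blast
qed

section \<open>Constancy of the metric\<close>

lemma lift_periodic: "(\<And>i. m $ i \<in> \<int>) \<Longrightarrow> lift f (y + m) = lift f y"
proof -
  assume "\<And>i. m $ i \<in> \<int>"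
  then have "torus_rel (y + m) y" by (simp add: torus_rel_def)
  then have "abs_torus (y + m) = abs_torus y" by (simp only: torus.abs_eq_iff)
  then show ?thesis by (simp add: lift_def)
qed

text \<open>The derivative on the torus is defined at one chosen representative. Periodicity carries it to every point
  of the fibre, which is needed for moving along lines in the universal cover.\<close>

lemma metric_has_derivative_on_cover:
  assumes g: "riemannian_metric g"
  shows "(lift g has_derivative dmetric g (abs_torus y)) (at y)"
proof -
  define m where "m = rep_torus (abs_torus y) - y"
  have "torus_rel (rep_torus (abs_torus y)) y"
    using Quotient_rel_rep Quotient_torus
    by (metis Quotient_abs_rep torus.abs_eq_iff)
  then have m: "m $ i \<in> \<int>" for i by (simp add: m_def torus_rel_def)
  have "((\<lambda>z. lift g (z + m)) has_derivative (\<lambda>h. dmetric g (abs_torus y) h)) (at y)"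
    by (rule has_derivative_compose[of "\<lambda>z. z + m" "\<lambda>h. h"])
      (auto intro!: derivative_eq_intros simp: m_def metric_has_derivative[OF g])
  then show ?thesis using lift_periodic[of m g] m by simp
qed

text \<open>By \<open>line\<close>, the forms at two points \<open>y\<close> and \<open>z\<close> agree
  on the vector \<open>z - y\<close>. As \<open>z\<close> may be moved by a period, they agree on all of the coset of \<open>z - y\<close>
  modulo the lattice. Their difference is a quadratic form, and one that vanishes on such a coset is
  zero, since its second differences in lattice directions vanish. In classical terms, a Killing 2-tensor
  of the flat torus is parallel.\<close>

lemma constant_along_lines_periodic:
  fixes h :: "real^'n::finite \<Rightarrow> real^'n^'n"
  assumes per: "\<And>m y. (\<And>i. m $ i \<in> \<int>) \<Longrightarrow> h (y + m) = h y"
    and sym: "\<And>y v w. bform (h y) v w = bform (h y) w v"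
    and line: "\<And>y v. bform (h (y + v)) v v = bform (h y) v v"
  shows "h y = h z"
proof -
  define K where "K = h z - h y"
  define d where "d = z - y"
  have K0: "bform K (d + of_nat k *\<^sub>R m) (d + of_nat k *\<^sub>R m) = 0" if "\<And>i. m $ i \<in> \<int>" for m k
  proof -
    let ?w = "d + of_nat k *\<^sub>R m"
    have "y + ?w = z + of_nat k *\<^sub>R m" by (simp add: d_def)
    moreover have "h (z + of_nat k *\<^sub>R m) = h z" by (rule per) (simp add: that)
    ultimately have "h (y + ?w) = h z" by (simp only:)
    with line[of y ?w] have "bform (h z) ?w ?w = bform (h y) ?w ?w" by (simp only:)
    moreover have "bform K ?w ?w = bform (h z) ?w ?w - bform (h y) ?w ?w"
      unfolding K_def by (rule bform_simps)
    ultimately show ?thesis by linarith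
  qed
  \<comment> \<open>The second difference in \<open>k\<close> of the vanishing quadratic polynomial \<open>K0\<close> is \<open>2 * bform K m m\<close>.\<close>
  have Kmm: "bform K m m = 0" if "\<And>i. m $ i \<in> \<int>" for m
    using K0[OF that, of 0] K0[OF that, of 1] K0[OF that, of 2] by simp
  have "K $ i $ j = 0" for i j
  proof -
    have "bform K (axis i 1 + axis j 1) (axis i 1 + axis j 1) = 0"
      "bform K (axis i 1) (axis i 1) = 0" "bform K (axis j 1) (axis j 1) = 0"
      by (rule Kmm, simp add: axis_def)+
    moreover have "bform K (axis i 1) (axis j 1) = bform K (axis j 1) (axis i 1)"
      using sym by (simp add: K_def)
    ultimately have "bform K (axis i 1) (axis j 1) = 0" by simp
    then show ?thesis by (simp add: bform_axis)
  qed
  then show ?thesis by (simp add: K_def vec_eq_iff)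
qed

lemma det_scaleR:
  fixes A :: "real^'n::finite^'n"
  shows "det (c *\<^sub>R A) = c ^ CARD('n) * det A"
  by (simp add: det_def prod.distrib sum_distrib_left mult_ac)

text \<open>The square makes the base of the power positive without any appeal to the sign of the determinant. Under
  the cubic identity the logarithmic derivative of this factor is \<open>-2\<close> times the contracted Christoffel
  form.\<close>

definition conformal_factor :: "real^'n::finite^'n \<Rightarrow> real" where
  "conformal_factor A = (det A)\<^sup>2 powr (- 1 / (real CARD('n) + 1))"

text \<open>In direction \<open>v\<close>, the logarithmic derivative of \<open>bform (g x) v v\<close> is twice the contracted Christoffel form
  by the cubic identity, and the conformal factor has the opposite logarithmic derivative.\<close>

lemma rescaled_constant_along_lines:
  fixes g :: "'n::finite metric"
  assumes g: "riemannian_metric g"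
    and min: "\<And>(p :: int^'n) s. primitive p \<Longrightarrow> minimal_hypersurface g (leaf p s)"
  defines "h \<equiv> \<lambda>y. conformal_factor (lift g y) *\<^sub>R lift g y"
  shows "bform (h (y + v)) v v = bform (h y) v v"
proof -
  define \<Phi> where "\<Phi> z = bform (h z) v v" for z
  define a where "a = - 1 / (real CARD('n) + 1)"
  have conf: "conformal_factor (lift g z) = (det (lift g z))\<^sup>2 powr a" for z
    by (simp only: conformal_factor_def a_def)
  have der: "\<exists>\<Phi>'. (\<Phi> has_derivative \<Phi>') (at z) \<and> \<Phi>' v = 0" for z
  proof -
    define x where "x = abs_torus z"
    have gx: "g x = lift g z" by (simp add: x_def lift_def)
    note pd = metric_spd[OF g, of x]
    obtain E where E: "orthonormal_wrt (g x) E" "span E = UNIV"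
      using orthonormal_basis_exists[OF pd, of UNIV] by (metis span_UNIV)
    have tr: "(\<Sum>e\<in>E. bform (dmetric g x v) e e) = (real CARD('n) + 1) * contracted_christoffel g x E v"
      by (rule cubic_identity_trace[OF pd E linear_dmetric[OF g] dmetric_sym[OF g]
            contracted_christoffel_linear[OF g] contracted_christoffel_def minimal_leaves_cubic_identity[OF g min E]])
    have dG: "(lift g has_derivative dmetric g x) (at z)"
      unfolding x_def by (rule metric_has_derivative_on_cover[OF g])
    define \<delta> where "\<delta> = det (lift g z)"
    have d0: "\<delta>\<^sup>2 > 0" using spd_det_nz[OF pd] by (simp add: \<delta>_def gx)
    define T where "T = (\<lambda>w. \<Sum>e\<in>E. bform (dmetric g x w) e e)"
    have "((\<lambda>z. det (lift g z)) has_derivative (\<lambda>w. \<delta> * T w)) (at z)"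
      unfolding \<delta>_def T_def
      by (rule det_has_derivative_trace[OF dG]) (use pd E in \<open>simp_all add: gx\<close>)
    then have "((\<lambda>z. (det (lift g z))\<^sup>2) has_derivative (\<lambda>w. 2 * \<delta>\<^sup>2 * T w)) (at z)"
      by (auto intro!: derivative_eq_intros simp: \<delta>_def power2_eq_square)
    from DERIV_compose_FDERIV[OF has_real_derivative_powr[OF d0[unfolded \<delta>_def]] this, of a]
    have "((\<lambda>z. (det (lift g z))\<^sup>2 powr a) has_derivative
        (\<lambda>w. 2 * \<delta>\<^sup>2 * T w * (a * (\<delta>\<^sup>2) powr (a - 1)))) (at z)"
      by (simp add: \<delta>_def)
    moreover have "2 * \<delta>\<^sup>2 * T w * (a * (\<delta>\<^sup>2) powr (a - 1)) = 2 * a * conformal_factor (lift g z) * T w" for w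
    proof -
      have "(\<delta>\<^sup>2) powr (a - 1) = (\<delta>\<^sup>2) powr a / \<delta>\<^sup>2"
        using d0 by (simp add: powr_diff)
      then show ?thesis using d0 by (simp add: conf \<delta>_def)
    qed
    ultimately have F: "((\<lambda>z. conformal_factor (lift g z)) has_derivative
        (\<lambda>w. 2 * a * conformal_factor (lift g z) * T w)) (at z)"
      by (simp only: conf)
    have B: "((\<lambda>z. bform (lift g z) v v) has_derivative (\<lambda>w. bform (dmetric g x w) v v)) (at z)"
      unfolding bform_def
      by (intro bounded_linear.has_derivative[OF bounded_linear_inner_right]
          bounded_linear.has_derivative[OF bounded_linear_matrix_vector_left] dG)
    have "\<Phi> = (\<lambda>z. conformal_factor (lift g z) * bform (lift g z) v v)"
      by (simp add: \<Phi>_def h_def fun_eq_iff)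
    then have "(\<Phi> has_derivative (\<lambda>w. conformal_factor (lift g z) * bform (dmetric g x w) v v
        + 2 * a * conformal_factor (lift g z) * T w * bform (lift g z) v v)) (at z)"
      using has_derivative_mult[OF F B] by simp
    moreover have "conformal_factor (lift g z) * bform (dmetric g x v) v v
        + 2 * a * conformal_factor (lift g z) * T v * bform (lift g z) v v = 0"
    proof -
      have "a * T v = - contracted_christoffel g x E v"
        unfolding T_def tr a_def by (simp add: field_simps)
      then have "(a * T v) * (2 * conformal_factor (lift g z) * bform (lift g z) v v)
          = - (conformal_factor (lift g z) * (2 * contracted_christoffel g x E v * bform (g x) v v))"
        by (simp add: gx)
      then have "2 * a * conformal_factor (lift g z) * T v * bform (lift g z) v v
          = - (conformal_factor (lift g z) * (2 * contracted_christoffel g x E v * bform (g x) v v))"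
        by (simp only: mult_ac)
      moreover have "bform (dmetric g x v) v v = 2 * contracted_christoffel g x E v * bform (g x) v v"
        by (rule minimal_leaves_cubic_identity[OF g min E])
      ultimately show ?thesis by (simp only: right_minus)
    qed
    ultimately show ?thesis by blast
  qed
  have "((\<lambda>t. \<Phi> (y + t *\<^sub>R v)) has_real_derivative 0) (at t)" for t
  proof -
    obtain \<Phi>' where P: "(\<Phi> has_derivative \<Phi>') (at (y + t *\<^sub>R v))" "\<Phi>' v = 0" using der by blast
    have "((\<lambda>t. y + t *\<^sub>R v) has_derivative (\<lambda>s. s *\<^sub>R v)) (at t)"
      by (auto intro!: derivative_eq_intros)
    from has_derivative_compose[OF this P(1)]
    have "((\<lambda>t. \<Phi> (y + t *\<^sub>R v)) has_derivative (\<lambda>s. \<Phi>' (s *\<^sub>R v))) (at t)" .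
    moreover have "\<Phi>' (s *\<^sub>R v) = 0" for s
      using linear_cmul[OF has_derivative_linear[OF P(1)]] P(2) by simp
    ultimately show ?thesis by (simp add: has_field_derivative_def lambda_zero[symmetric])
  qed
  from DERIV_isconst_all[OF allI[OF this], of 1 0]
  show ?thesis by (simp add: \<Phi>_def)
qed

text \<open>Constancy of the rescaled metric leaves only a conformal change between two points. Taking determinants,
  \<open>(1 - 2n/(n+1)) ln (det g)\<^sup>2\<close> is constant, and the coefficient is nonzero exactly because \<open>n \<noteq> 1\<close>.\<close>

lemma metric_constant:
  fixes g :: "'n::finite metric"
  assumes n: "CARD('n) \<ge> 2"
    and g: "riemannian_metric g"
    and min: "\<And>(p :: int^'n) s. primitive p \<Longrightarrow> minimal_hypersurface g (leaf p s)"
  shows "g x = g y"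
proof -
  define h where "h = (\<lambda>y. conformal_factor (lift g y) *\<^sub>R lift g y)"
  have "h (rep_torus x) = h (rep_torus y)"
  proof (rule constant_along_lines_periodic)
    show "h (z + m) = h z" if "\<And>i. m $ i \<in> \<int>" for m z
      using lift_periodic[of m g] that by (simp add: h_def)
    show "bform (h z) v w = bform (h z) w v" for z v w
      using spd_sym[OF metric_spd[OF g]] by (simp add: h_def lift_def)
    show "bform (h (z + v)) v v = bform (h z) v v" for z v
      unfolding h_def by (rule rescaled_constant_along_lines[OF g min])
  qed
  then have eq: "conformal_factor (g x) *\<^sub>R g x = conformal_factor (g y) *\<^sub>R g y"
    by (simp add: h_def)
  have dx: "(det (g x))\<^sup>2 > 0" and dy: "(det (g y))\<^sup>2 > 0"
    using spd_det_nz[OF metric_spd[OF g]] by simp_all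
  let ?n = "real CARD('n)"
  have "conformal_factor (g x) ^ CARD('n) * det (g x) = conformal_factor (g y) ^ CARD('n) * det (g y)"
    using arg_cong[OF eq, of det] by (simp add: det_scaleR)
  then have "ln ((conformal_factor (g x) ^ CARD('n))\<^sup>2 * (det (g x))\<^sup>2) = ln ((conformal_factor (g y) ^ CARD('n))\<^sup>2 * (det (g y))\<^sup>2)"
    by (simp only: power_mult_distrib[symmetric])
  moreover have "ln ((conformal_factor A ^ CARD('n))\<^sup>2 * (det A)\<^sup>2) = (1 - 2 * ?n / (?n + 1)) * ln ((det A)\<^sup>2)"
    if "(det A)\<^sup>2 > 0" for A :: "real^'n^'n"
  proof -
    have c: "conformal_factor A > 0" using that by (simp add: conformal_factor_def)
    have "ln ((conformal_factor A ^ CARD('n))\<^sup>2) = 2 * (?n * ln (conformal_factor A))"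
      using c by (simp add: ln_realpow)
    also have "ln (conformal_factor A) = - 1 / (?n + 1) * ln ((det A)\<^sup>2)"
      unfolding conformal_factor_def using that by (subst ln_powr) auto
    finally show ?thesis
      using c that by (subst ln_mult_pos) (simp_all add: algebra_simps)
  qed
  ultimately have "(1 - 2 * ?n / (?n + 1)) * ln ((det (g x))\<^sup>2) = (1 - 2 * ?n / (?n + 1)) * ln ((det (g y))\<^sup>2)"
    using dx dy by simp
  moreover have "1 - 2 * ?n / (?n + 1) \<noteq> 0" using n by (simp add: field_simps)
  ultimately have "ln ((det (g x))\<^sup>2) = ln ((det (g y))\<^sup>2)" by (metis mult_left_cancel)
  then have "(det (g x))\<^sup>2 = (det (g y))\<^sup>2" using dx dy by (simp only: ln_inj_iff)
  then have "conformal_factor (g x) = conformal_factor (g y)" by (simp add: conformal_factor_def)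
  moreover have "conformal_factor (g y) \<noteq> 0" using dy by (simp add: conformal_factor_def)
  ultimately show ?thesis using eq by simp
qed

lemma torus_deriv_const: "torus_deriv (\<lambda>_. c) x v = 0"
  by (simp add: torus_deriv_def o_def)

lemma constant_metric_flat: "flat (\<lambda>_. H)"
proof -
  have "christoffel (\<lambda>_. H) k i j = (\<lambda>_. 0)" for k i j
    by (simp add: christoffel_def torus_deriv_const fun_eq_iff)
  then show ?thesis by (simp add: flat_def riemann_curvature_def torus_deriv_const)
qed

theorem theoremC1:
  fixes g :: "'n::finite metric"
  assumes "CARD('n) \<ge> 2"
    and "riemannian_metric g"
    and "\<And>(p :: int^'n) s. primitive p \<Longrightarrow> minimal_hypersurface g (leaf p s)"
  shows "(\<forall>i j. \<exists>c. \<forall>x. g x $ i $ j = c) \<and> flat g"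
proof -
  obtain H where "g = (\<lambda>_. H)"
    using metric_constant[OF assms] by (metis ext)
  then show ?thesis using constant_metric_flat by auto
qed

end
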